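(* Let $(\mathcal{M},g)$ be an $n$-dimensional spacetime with Levi-Civita connection $\nabla$, let $\{e_A\}_{A=0}^{n-1}$ be a smooth orthonormal frame (tetrad) on an open set $U\subset\mathcal{M}$ with components $e_A{}^\mu$, where $e_0$ is timelike, and let $\Lambda^A{}_B$ be a local (smooth, point-dependent) Lorentz transformation on $U$. Put $u^\mu=e_0{}^\mu$, $f=\Lambda^0{}_0$, and $b^\mu=\Lambda^i{}_0\,e_i{}^\mu$ (sum over $i=1,\dots,n-1$). Assume that the observer $u^\mu$ satisfies the condition for the foliation, i.e. its vorticity vanishes: $\omega_{\mu\nu}=0$. Then the Lorentz-transformed observer $\tilde u^\mu=\Lambda^A{}_0\,e_A{}^\mu=f u^\mu+b^\mu$ also admits a foliation if the following equation is satisfied on $U$: $$0 = u_{[\mu}\nabla_{\nu]}f+\nabla_{[\nu}b_{\mu]}+f\,\dot u_{[\mu}\big(f\tilde u_{\nu]}-u_{\nu]}\big)+u_{[\mu}b_{\nu]}\Big(\nabla_{\tilde u}f-\frac{1}{n-1}\Theta f^2\Big)+\Big[\nabla_{\tilde u}b_{[\mu}+f\,b^\rho\sigma_{\rho[\mu}\Big]\tilde u_{\nu]},$$ where $\dot u^\mu$, $\Theta$ and $\sigma_{\mu\nu}$ are the acceleration, expansion and shear of $u^\mu$.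
   Context: A spacetime is a smooth manifold with a Lorentzian metric of signature $(-,+,\dots,+)$. An observer on an open set $U$ is a smooth vector field $u^\mu$ on $U$ with $g_{\mu\nu}u^\mu u^\nu=-1$. A tetrad is a frame with $g_{\mu\nu}e_A{}^\mu e_B{}^\nu=\eta_{AB}$, $\eta=\mathrm{diag}(-1,1,\dots,1)$. A local Lorentz transformation is a smooth matrix-valued function $\Lambda^A{}_B$ with $\eta_{AB}\Lambda^A{}_C\Lambda^B{}_D=\eta_{CD}$; it acts on tetrads by $\tilde e_A{}^\mu=\Lambda^B{}_A e_B{}^\mu$. Spacetime indices are raised and lowered with $g$. Notation: $\nabla_X:=X^\mu\nabla_\mu$, and in particular $\nabla_{\tilde u}b_\mu:=\tilde u^\rho\nabla_\rho b_\mu$; $T_{[\mu\nu]}=\tfrac12(T_{\mu\nu}-T_{\nu\mu})$, $T_{(\mu\nu)}=\tfrac12(T_{\mu\nu}+T_{\nu\mu})$ (antisymmetrization and symmetrization are over the free indices $\mu,\nu$ only, in the order written). For an observer $u^\mu$ the kinematic characteristics are: acceleration $\dot u^\mu:=u^\rho\nabla_\rho u^\mu$; expansion $\Theta:=\nabla_\rho u^\rho$; vorticity $\omega_{\mu\nu}:=\nabla_{[\nu}u_{\mu]}+\dot u_{[\mu}u_{\nu]}$; shear $\sigma_{\mu\nu}:=\nabla_{(\nu}u_{\mu)}+\dot u_{(\mu}u_{\nu)}-\frac{1}{n-1}\Theta h_{\mu\nu}$, with $h_{\mu\nu}:=g_{\mu\nu}+u_\mu u_\nu$. An observer "admits a foliation"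 if the $(n-1)$-dimensional distribution orthogonal to it is (completely) integrable, i.e. is tangent to a foliation by hypersurfaces; this is equivalent (Frobenius) to the vanishing of the vorticity of that observer. *)

theory Defs
  imports "HOL-Analysis.Analysis"
begin

section \<open>Smooth functions on open subsets of Euclidean space\<close>

text \<open>Meant for open \<open>S\<close>: \<open>f\<close> is \<open>k\<close> times continuously differentiable on \<open>S\<close>.\<close>

primrec Ck_on :: "nat \<Rightarrow> 'a::euclidean_space set \<Rightarrow> ('a \<Rightarrow> 'b::real_normed_vector) \<Rightarrow> bool" where
  "Ck_on 0 S f \<longleftrightarrow> continuous_on S f"
| "Ck_on (Suc k) S f \<longleftrightarrow>
     (\<forall>x\<in>S. f differentiable (at x)) \<and> (\<forall>v. Ck_on k S (\<lambda>x. frechet_derivative f (at x) v))"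

definition smooth_on :: "'a::euclidean_space set \<Rightarrow> ('a \<Rightarrow> 'b::real_normed_vector) \<Rightarrow> bool" where
  "smooth_on S f \<longleftrightarrow> (\<forall>k. Ck_on k S f)"


section \<open>Smooth manifolds\<close>

text \<open>A chart is a pair of a domain and a coordinate map; the values of the coordinate map outside
  the domain are irrelevant. The dimension is \<open>CARD('n)\<close>.\<close>

type_synonym ('m, 'n) chart = "'m set \<times> ('m \<Rightarrow> real ^ 'n)"

abbreviation cdom :: "('m, 'n) chart \<Rightarrow> 'm set" where "cdom c \<equiv> fst c"
abbreviation cmap :: "('m, 'n) chart \<Rightarrow> 'm \<Rightarrow> real ^ 'n" where "cmap c \<equiv> snd c"

definition cinv :: "('m, 'n) chart \<Rightarrow> real ^ 'n \<Rightarrow> 'm" where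
  "cinv c = inv_into (cdom c) (cmap c)"

definition is_chart :: "('m::topological_space, 'n::finite) chart \<Rightarrow> bool" where
  "is_chart c \<longleftrightarrow> open (cdom c) \<and> open (cmap c ` cdom c) \<and>
     homeomorphism (cdom c) (cmap c ` cdom c) (cmap c) (cinv c)"

definition transition :: "('m, 'n) chart \<Rightarrow> ('m, 'n) chart \<Rightarrow> real ^ 'n \<Rightarrow> real ^ 'n" where
  "transition c d = cmap d \<circ> cinv c"

definition compatible :: "('m, 'n::finite) chart \<Rightarrow> ('m, 'n) chart \<Rightarrow> bool" where
  "compatible c d \<longleftrightarrow>
     smooth_on (cmap c ` (cdom c \<inter> cdom d)) (transition c d) \<and>
     smooth_on (cmap d ` (cdom c \<inter> cdom d)) (transition d c)"

text \<open>The manifold is the whole type \<open>'m\<close>, and \<open>A\<close> is its maximal smooth atlas.\<close>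

definition smooth_manifold ::
  "('m::{t2_space, second_countable_topology}, 'n::finite) chart set \<Rightarrow> bool" where
  "smooth_manifold A \<longleftrightarrow>
     (\<forall>c\<in>A. is_chart c) \<and> (\<Union>c\<in>A. cdom c) = UNIV \<and>
     (\<forall>c\<in>A. \<forall>d\<in>A. compatible c d) \<and>
     (\<forall>c. is_chart c \<and> (\<forall>d\<in>A. compatible c d) \<longrightarrow> c \<in> A)"


section \<open>Fields\<close>

text \<open>Tensor fields are given by their components at a point with respect to each chart around this
  point, subject to the transformation law. Components at points outside the chart domain (or
  outside the set on which the field is considered) are irrelevant.\<close>

type_synonym ('m, 'n) vfield = "('m, 'n) chart \<Rightarrow> 'm \<Rightarrow> real ^ 'n"
type_synonym ('m, 'n) metric = "('m, 'n) chart \<Rightarrow> 'm \<Rightarrow> real ^ 'n ^ 'n"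

definition jac :: "('m, 'n::finite) chart \<Rightarrow> ('m, 'n) chart \<Rightarrow> 'm \<Rightarrow> real ^ 'n \<Rightarrow> real ^ 'n" where
  "jac c d p = frechet_derivative (transition c d) (at (cmap c p))"

definition smooth_scalar :: "('m, 'n::finite) chart set \<Rightarrow> 'm set \<Rightarrow> ('m \<Rightarrow> real) \<Rightarrow> bool" where
  "smooth_scalar A U f \<longleftrightarrow> (\<forall>c\<in>A. smooth_on (cmap c ` (cdom c \<inter> U)) (f \<circ> cinv c))"

definition smooth_vfield :: "('m, 'n::finite) chart set \<Rightarrow> 'm set \<Rightarrow> ('m, 'n) vfield \<Rightarrow> bool" where
  "smooth_vfield A U X \<longleftrightarrow>
     (\<forall>c\<in>A. smooth_on (cmap c ` (cdom c \<inter> U)) (X c \<circ> cinv c)) \<and>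
     (\<forall>c\<in>A. \<forall>d\<in>A. \<forall>p\<in>cdom c \<inter> cdom d \<inter> U. X d p = jac c d p (X c p))"

definition gprod :: "('m, 'n::finite) metric \<Rightarrow> ('m, 'n) chart \<Rightarrow> 'm \<Rightarrow> real ^ 'n \<Rightarrow> real ^ 'n \<Rightarrow> real" where
  "gprod g c p v w = (\<Sum>\<mu>\<in>UNIV. \<Sum>\<nu>\<in>UNIV. g c p $ \<mu> $ \<nu> * v $ \<mu> * w $ \<nu>)"

text \<open>Frame indices are the natural numbers below the dimension, the index 0 being timelike.\<close>

definition \<eta> :: "nat \<Rightarrow> nat \<Rightarrow> real" where
  "\<eta> A B = (if A \<noteq> B then 0 else if A = 0 then - 1 else 1)"

text \<open>The last conjunct is the signature condition: at each point there is a basis in which the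
  metric is \<open>diag(-1,1,\<dots>,1)\<close> (linear independence being automatic).\<close>

definition lorentzian_metric :: "('m, 'n::finite) chart set \<Rightarrow> ('m, 'n) metric \<Rightarrow> bool" where
  "lorentzian_metric A g \<longleftrightarrow>
     (\<forall>c\<in>A. smooth_on (cmap c ` cdom c) (g c \<circ> cinv c)) \<and>
     (\<forall>c\<in>A. \<forall>d\<in>A. \<forall>p\<in>cdom c \<inter> cdom d. \<forall>v w.
        gprod g c p v w = gprod g d p (jac c d p v) (jac c d p w)) \<and>
     (\<forall>c\<in>A. \<forall>p\<in>cdom c. transpose (g c p) = g c p) \<and>
     (\<forall>c\<in>A. \<forall>p\<in>cdom c. \<exists>E :: nat \<Rightarrow> real ^ 'n.
        \<forall>A<CARD('n). \<forall>B<CARD('n). gprod g c p (E A) (E B) = \<eta> A B)"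

definition spacetime ::
  "('m::{t2_space, second_countable_topology}, 'n::finite) chart set \<Rightarrow> ('m, 'n) metric \<Rightarrow> bool" where
  "spacetime A g \<longleftrightarrow> smooth_manifold A \<and> lorentzian_metric A g"

definition tetrad ::
  "('m, 'n::finite) chart set \<Rightarrow> ('m, 'n) metric \<Rightarrow> 'm set \<Rightarrow> (nat \<Rightarrow> ('m, 'n) vfield) \<Rightarrow> bool" where
  "tetrad A g U e \<longleftrightarrow>
     (\<forall>B<CARD('n). smooth_vfield A U (e B)) \<and>
     (\<forall>c\<in>A. \<forall>p\<in>cdom c \<inter> U. \<forall>B<CARD('n). \<forall>C<CARD('n).
        gprod g c p (e B c p) (e C c p) = \<eta> B C)"

text \<open>\<open>\<Lambda> B C p\<close> is the matrix entry with upper index \<open>B\<close> and lower index \<open>C\<close> at the point \<open>p\<close>.\<close>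

definition local_lorentz ::
  "('m, 'n::finite) chart set \<Rightarrow> 'm set \<Rightarrow> (nat \<Rightarrow> nat \<Rightarrow> 'm \<Rightarrow> real) \<Rightarrow> bool" where
  "local_lorentz A U \<Lambda> \<longleftrightarrow>
     (\<forall>B<CARD('n). \<forall>C<CARD('n). smooth_scalar A U (\<Lambda> B C)) \<and>
     (\<forall>p\<in>U. \<forall>C<CARD('n). \<forall>D<CARD('n).
        (\<Sum>A<CARD('n). \<Sum>B<CARD('n). \<eta> A B * \<Lambda> A C p * \<Lambda> B D p) = \<eta> C D)"


section \<open>Levi-Civita connection in components\<close>

definition pd :: "('m, 'n::finite) chart \<Rightarrow> 'n \<Rightarrow> ('m \<Rightarrow> real) \<Rightarrow> 'm \<Rightarrow> real" where
  "pd c \<mu> F p = frechet_derivative (F \<circ> cinv c) (at (cmap c p)) (axis \<mu> 1)"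

text \<open>\<open>christoffel g c p l m k\<close> has upper index \<open>l\<close> and lower indices \<open>m\<close>, \<open>k\<close>.\<close>

definition christoffel ::
  "('m, 'n::finite) metric \<Rightarrow> ('m, 'n) chart \<Rightarrow> 'm \<Rightarrow> 'n \<Rightarrow> 'n \<Rightarrow> 'n \<Rightarrow> real" where
  "christoffel g c p l m k =
     1 / 2 * (\<Sum>\<rho>\<in>UNIV. matrix_inv (g c p) $ l $ \<rho> *
       (pd c m (\<lambda>q. g c q $ k $ \<rho>) p + pd c k (\<lambda>q. g c q $ m $ \<rho>) p - pd c \<rho> (\<lambda>q. g c q $ m $ k) p))"

text \<open>\<open>nabla_vec g X c p \<mu> \<nu>\<close> and \<open>nabla_cov g w c p \<mu> \<nu>\<close> are the derivatives in the direction \<open>\<mu>\<close> of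
  the component \<open>\<nu>\<close> of a vector field, respectively a covector field.\<close>

definition nabla_vec ::
  "('m, 'n::finite) metric \<Rightarrow> ('m, 'n) vfield \<Rightarrow> ('m, 'n) chart \<Rightarrow> 'm \<Rightarrow> 'n \<Rightarrow> 'n \<Rightarrow> real" where
  "nabla_vec g X c p \<mu> \<nu> =
     pd c \<mu> (\<lambda>q. X c q $ \<nu>) p + (\<Sum>l\<in>UNIV. christoffel g c p \<nu> \<mu> l * X c p $ l)"

definition nabla_cov ::
  "('m, 'n::finite) metric \<Rightarrow> ('m, 'n) vfield \<Rightarrow> ('m, 'n) chart \<Rightarrow> 'm \<Rightarrow> 'n \<Rightarrow> 'n \<Rightarrow> real" where
  "nabla_cov g w c p \<mu> \<nu> =
     pd c \<mu> (\<lambda>q. w c q $ \<nu>) p - (\<Sum>l\<in>UNIV. christoffel g c p l \<mu> \<nu> * w c p $ l)"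

text \<open>Index lowering; the result is a family of covector components.\<close>

definition low :: "('m, 'n::finite) metric \<Rightarrow> ('m, 'n) vfield \<Rightarrow> ('m, 'n) vfield" where
  "low g X c p = (\<chi> \<mu>. \<Sum>\<nu>\<in>UNIV. g c p $ \<mu> $ \<nu> * X c p $ \<nu>)"

text \<open>\<open>X\<^sup>\<rho> \<nabla>\<^sub>\<rho> f\<close> for a scalar \<open>f\<close>, and \<open>X\<^sup>\<rho> \<nabla>\<^sub>\<rho> w\<^sub>\<mu>\<close> for a covector field \<open>w\<close>.\<close>

definition along_scalar ::
  "('m, 'n::finite) vfield \<Rightarrow> ('m \<Rightarrow> real) \<Rightarrow> ('m, 'n) chart \<Rightarrow> 'm \<Rightarrow> real" where
  "along_scalar X f c p = (\<Sum>\<rho>\<in>UNIV. X c p $ \<rho> * pd c \<rho> f p)"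

definition along_cov ::
  "('m, 'n::finite) metric \<Rightarrow> ('m, 'n) vfield \<Rightarrow> ('m, 'n) vfield \<Rightarrow> ('m, 'n) vfield" where
  "along_cov g X w c p = (\<chi> \<mu>. \<Sum>\<rho>\<in>UNIV. X c p $ \<rho> * nabla_cov g w c p \<rho> \<mu>)"

definition antisym2 :: "('n \<Rightarrow> 'n \<Rightarrow> real) \<Rightarrow> 'n \<Rightarrow> 'n \<Rightarrow> real" where
  "antisym2 T \<mu> \<nu> = 1 / 2 * (T \<mu> \<nu> - T \<nu> \<mu>)"

definition sym2 :: "('n \<Rightarrow> 'n \<Rightarrow> real) \<Rightarrow> 'n \<Rightarrow> 'n \<Rightarrow> real" where
  "sym2 T \<mu> \<nu> = 1 / 2 * (T \<mu> \<nu> + T \<nu> \<mu>)"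


section \<open>Kinematic characteristics of an observer\<close>

definition accel :: "('m, 'n::finite) metric \<Rightarrow> ('m, 'n) vfield \<Rightarrow> ('m, 'n) vfield" where
  "accel g u c p = (\<chi> \<mu>. \<Sum>\<rho>\<in>UNIV. u c p $ \<rho> * nabla_vec g u c p \<rho> \<mu>)"

definition expansion ::
  "('m, 'n::finite) metric \<Rightarrow> ('m, 'n) vfield \<Rightarrow> ('m, 'n) chart \<Rightarrow> 'm \<Rightarrow> real" where
  "expansion g u c p = (\<Sum>\<rho>\<in>UNIV. nabla_vec g u c p \<rho> \<rho>)"

text \<open>Brackets refer to the indices in the order written, so \<open>\<nabla>\<^bsub>[\<nu>\<^esub>u\<^bsub>\<mu>]\<^esub>\<close> is \<open>antisym2\<close> of
  \<open>\<lambda>a b. \<nabla>\<^sub>a u\<^sub>b\<close> at \<open>\<nu> \<mu>\<close>.\<close>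

definition vorticity ::
  "('m, 'n::finite) metric \<Rightarrow> ('m, 'n) vfield \<Rightarrow> ('m, 'n) chart \<Rightarrow> 'm \<Rightarrow> 'n \<Rightarrow> 'n \<Rightarrow> real" where
  "vorticity g u c p \<mu> \<nu> =
     antisym2 (nabla_cov g (low g u) c p) \<nu> \<mu> +
     antisym2 (\<lambda>a b. low g (accel g u) c p $ a * low g u c p $ b) \<mu> \<nu>"

definition shear ::
  "('m, 'n::finite) metric \<Rightarrow> ('m, 'n) vfield \<Rightarrow> ('m, 'n) chart \<Rightarrow> 'm \<Rightarrow> 'n \<Rightarrow> 'n \<Rightarrow> real" where
  "shear g u c p \<mu> \<nu> =
     sym2 (nabla_cov g (low g u) c p) \<nu> \<mu> +
     sym2 (\<lambda>a b. low g (accel g u) c p $ a * low g u c p $ b) \<mu> \<nu> -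
     1 / (real CARD('n) - 1) * expansion g u c p *
       (g c p $ \<mu> $ \<nu> + low g u c p $ \<mu> * low g u c p $ \<nu>)"


section \<open>Foliations by hypersurfaces\<close>

text \<open>A foliation of the open set \<open>U\<close> by hypersurfaces is given by a foliated atlas: a set \<open>F\<close> of
  box-shaped charts of the manifold covering \<open>U\<close>, each with a distinguished transverse coordinate
  \<open>k c\<close>, the plaques of a chart \<open>c\<close> being its slices on which the coordinate \<open>k c\<close> is constant.
  The last conjunct says that the plaques of any two charts fit together to leaves: locally,
  points on a common plaque of one chart are on a common plaque of the other.\<close>

definition hypersurface_foliation ::
  "('m::topological_space, 'n::finite) chart set \<Rightarrow> 'm set \<Rightarrow>
   ('m, 'n) chart set \<Rightarrow> (('m, 'n) chart \<Rightarrow> 'n) \<Rightarrow> bool" where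
  "hypersurface_foliation A U F k \<longleftrightarrow>
     F \<subseteq> A \<and> (\<Union>c\<in>F. cdom c) = U \<and>
     (\<forall>c\<in>F. \<exists>a b. cmap c ` cdom c = box a b) \<and>
     (\<forall>c\<in>F. \<forall>d\<in>F. \<forall>p\<in>cdom c \<inter> cdom d. \<exists>W. open W \<and> p \<in> W \<and> W \<subseteq> cdom c \<inter> cdom d \<and>
        (\<forall>q\<in>W. \<forall>r\<in>W. cmap c q $ k c = cmap c r $ k c \<longrightarrow> cmap d q $ k d = cmap d r $ k d))"

definition orth ::
  "('m, 'n::finite) metric \<Rightarrow> ('m, 'n) vfield \<Rightarrow> ('m, 'n) chart \<Rightarrow> 'm \<Rightarrow> (real ^ 'n) set" where
  "orth g u c p = {v. gprod g c p (u c p) v = 0}"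

text \<open>The distribution orthogonal to \<open>u\<close> is tangent to the leaves of some foliation of \<open>U\<close>. In a
  foliated chart the tangent space of the leaf is spanned by the coordinate directions other than
  the transverse one.\<close>

definition admits_foliation ::
  "('m::topological_space, 'n::finite) chart set \<Rightarrow> ('m, 'n) metric \<Rightarrow> 'm set \<Rightarrow> ('m, 'n) vfield \<Rightarrow> bool" where
  "admits_foliation A g U u \<longleftrightarrow>
     (\<exists>F k. hypersurface_foliation A U F k \<and>
        (\<forall>c\<in>F. \<forall>p\<in>cdom c. orth g u c p = {v. v $ k c = 0}))"

end

theory Submission
  imports Defs
begin

text \<open>
  Write \<open>v\<close> for the transformed observer \<open>f u + b\<close>. Since \<open>u \<and> b = u \<and> v\<close>, substituting \<open>\<omega> = 0\<close> into
  the hypothesis turns it into \<open>dv = \<zeta> \<and> v\<close> for some covector \<open>\<zeta>\<close>. What \<open>\<zeta>\<close> is made of does not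
  matter, so neither the compatibility of the connection with the metric nor the values of the
  shear and the expansion enter. It remains to prove the theorem of Frobenius for one nowhere
  vanishing 1-form.

  Where its component \<open>k\<close> does not vanish, the form is proportional to \<open>dx\<^sub>k - \<alpha>\<close> with
  \<open>\<alpha>\<^sub>k = 0\<close>. A leaf is a graph \<open>x\<^sub>k = Z\<close> that satisfies \<open>\<partial>\<^sub>i Z = \<alpha>\<^sub>i\<close>; along the rays through the
  origin this is a single scalar ordinary differential equation, solved by the contraction
  principle with its initial value \<open>q\<^sub>k\<close> at the origin as a further parameter. By integrability,
  \<open>\<Sum>\<alpha>\<^sub>i h\<^sub>i + W h\<^sub>k\<close> solves the linearised equation, where \<open>W\<close>, the derivative with respect to the
  initial value, is the exponential of an integral because the equation is scalar; so this is the
  derivative of \<open>Z\<close>. The formula expresses it through \<open>Z\<close> itself, which yields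
  smoothness by induction. The map \<open>(x, q\<^sub>k) \<mapsto> (x, Z)\<close> is injective, hence open by invariance of
  domain, and the component \<open>k\<close> of its inverse is the transverse coordinate of a foliated chart.
\<close>

section \<open>Calculus of smooth functions\<close>

lemma Ck_on_derivative:
  "Ck_on (Suc k) S f \<Longrightarrow> x \<in> S \<Longrightarrow> (f has_derivative frechet_derivative f (at x)) (at x)"
  by (simp add: frechet_derivative_works)

text \<open>Derivatives are local, so agreement on the open set \<open>S\<close> suffices. This
  matters for functions built from chart inverses, whose values off the chart image are
  arbitrary.\<close>

lemma Ck_on_cong:
  fixes f g :: "'a::euclidean_space \<Rightarrow> 'b::real_normed_vector"
  assumes "open S" "S \<subseteq> T" "\<And>x. x \<in> S \<Longrightarrow> f x = g x" "Ck_on k T f"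
  shows "Ck_on k S g"
  using assms
proof (induction k arbitrary: f g)
  case 0
  then show ?case by (metis Ck_on.simps(1) continuous_on_cong continuous_on_subset)
next
  case (Suc k)
  have D: "(g has_derivative frechet_derivative f (at x)) (at x)" if "x \<in> S" for x
    using has_derivative_transform_within_open[of f _ x UNIV S g] Suc.prems that Ck_on_derivative[of k T f x]
    by blast
  have "Ck_on k S (\<lambda>x. frechet_derivative g (at x) v)" for v
  proof (rule Suc.IH[of "\<lambda>x. frechet_derivative f (at x) v"])
    show "Ck_on k T (\<lambda>x. frechet_derivative f (at x) v)" using Suc.prems by simp
    show "frechet_derivative f (at x) v = frechet_derivative g (at x) v" if "x \<in> S" for x
      using frechet_derivative_at[OF D[OF that]] by simp
  qed (use Suc.prems in auto)
  then show ?case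
    using differentiableI[OF D] by simp
qed

text \<open>Any explicit formula \<open>f'\<close> may stand in for
  \<open>frechet_derivative\<close>. The inductions on the order below rely on this: they feed in
  the formulas of the product, chain or inverse rule.\<close>

lemma Ck_on_SucI:
  assumes "open S" and D: "\<And>x. x \<in> S \<Longrightarrow> (f has_derivative f' x) (at x)"
    and Ck: "\<And>v. Ck_on k S (\<lambda>x. f' x v)"
  shows "Ck_on (Suc k) S f"
proof -
  have "Ck_on k S (\<lambda>x. frechet_derivative f (at x) v)" for v
    using Ck_on_cong[OF \<open>open S\<close> order_refl _ Ck[of v]] frechet_derivative_at[OF D] by simp
  then show ?thesis
    using differentiableI[OF D] by simp
qed

lemma Ck_on_subset:
  "Ck_on k T f \<Longrightarrow> S \<subseteq> T \<Longrightarrow> Ck_on k S f"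
  by (induction k arbitrary: f) (auto intro: continuous_on_subset)

lemma Ck_on_SucD: "Ck_on (Suc k) S f \<Longrightarrow> Ck_on k S f"
proof (induction k arbitrary: f)
  case 0
  then show ?case
    by (simp add: continuous_at_imp_continuous_on differentiable_imp_continuous_within)
next
  case (Suc k)
  then show ?case by (simp)
qed

lemma Ck_on_imp_continuous_on: "Ck_on k S f \<Longrightarrow> continuous_on S f"
  by (induction k) (use Ck_on_SucD in auto)

lemma Ck_on_const: "Ck_on k S (\<lambda>x. c)"
  by (induction k arbitrary: c) (auto simp: frechet_derivative_const)

lemma Ck_on_bounded_linear:
  fixes f :: "'a::euclidean_space \<Rightarrow> 'b::real_normed_vector"
    and L :: "'b \<Rightarrow> 'c::real_normed_vector"
  assumes L: "bounded_linear L" and "open S"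
  shows "Ck_on k S f \<Longrightarrow> Ck_on k S (\<lambda>x. L (f x))"
proof (induction k arbitrary: f)
  case 0
  then show ?case by (simp add: L bounded_linear.continuous_on)
next
  case (Suc k)
  show ?case
  proof (rule Ck_on_SucI[OF \<open>open S\<close>])
    show "((\<lambda>x. L (f x)) has_derivative (\<lambda>v. L (frechet_derivative f (at x) v))) (at x)"
      if "x \<in> S" for x
      using Ck_on_derivative[OF Suc.prems that] L bounded_linear.has_derivative by blast
  qed (use Suc in auto)
qed

lemma Ck_on_add:
  assumes "open S"
  shows "Ck_on k S f \<Longrightarrow> Ck_on k S g \<Longrightarrow> Ck_on k S (\<lambda>x. f x + g x)"
proof (induction k arbitrary: f g)
  case 0
  then show ?case by (simp add: continuous_on_add)
next
  case (Suc k)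
  show ?case
  proof (rule Ck_on_SucI[OF \<open>open S\<close>])
    show "((\<lambda>x. f x + g x) has_derivative
        (\<lambda>v. frechet_derivative f (at x) v + frechet_derivative g (at x) v)) (at x)"
      if "x \<in> S" for x
      using Ck_on_derivative[OF Suc.prems(1) that] Ck_on_derivative[OF Suc.prems(2) that]
      by (rule has_derivative_add)
  qed (use Suc in auto)
qed

lemma Ck_on_sum:
  assumes "open S" "\<And>i. i \<in> I \<Longrightarrow> Ck_on k S (f i)"
  shows "Ck_on k S (\<lambda>x. \<Sum>i\<in>I. f i x)"
  using assms(2)
  by (induction I rule: infinite_finite_induct) (auto intro: Ck_on_const Ck_on_add[OF assms(1)])

text \<open>The product rule yields a sum of two products of the same kind, so the induction
  generalises over both factors. Multiplication, scaling and inner product are all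
  instances.\<close>

lemma Ck_on_bilinear:
  assumes B: "bounded_bilinear B" and "open S"
  shows "Ck_on k S f \<Longrightarrow> Ck_on k S g \<Longrightarrow> Ck_on k S (\<lambda>x. B (f x) (g x))"
proof (induction k arbitrary: f g)
  case 0
  then show ?case by (simp add: bounded_bilinear.continuous_on[OF B])
next
  case (Suc k)
  show ?case
  proof (rule Ck_on_SucI[OF \<open>open S\<close>])
    show "((\<lambda>x. B (f x) (g x)) has_derivative
        (\<lambda>v. B (f x) (frechet_derivative g (at x) v) + B (frechet_derivative f (at x) v) (g x))) (at x)"
      if "x \<in> S" for x
      using Ck_on_derivative[OF Suc.prems(1) that] Ck_on_derivative[OF Suc.prems(2) that]
      by (rule bounded_bilinear.FDERIV[OF B])
      show "Ck_on k S (\<lambda>x. B (f x) (frechet_derivative g (at x) v) + B (frechet_derivative f (at x) v) (g x))"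
      for v
      by (intro Ck_on_add[OF \<open>open S\<close>] Suc.IH Ck_on_SucD[OF Suc.prems(1)] Ck_on_SucD[OF Suc.prems(2)])
        (use Suc.prems in auto)
  qed
qed

lemmas Ck_on_mult = Ck_on_bilinear[OF bounded_bilinear_mult]
lemmas Ck_on_scaleR = Ck_on_bilinear[OF bounded_bilinear_scaleR]
lemmas Ck_on_inner = Ck_on_bilinear[OF bounded_bilinear_inner]

lemma Ck_on_id: "open S \<Longrightarrow> Ck_on k S (\<lambda>x. x)"
proof (induction k)
  case (Suc k)
  show ?case
    by (rule Ck_on_SucI[OF Suc.prems, where f' = "\<lambda>x v. v"]) (auto intro: Ck_on_const)
qed auto

text \<open>In the chain rule the direction in which \<open>g\<close> is differentiated varies with
  \<open>x\<close>. Expanding this direction in the basis leaves derivatives of \<open>g\<close> in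
  fixed directions \<open>b\<close>, composed with \<open>f\<close>, and to these the induction
  hypothesis applies.\<close>

lemma Ck_on_compose:
  fixes f :: "'a::euclidean_space \<Rightarrow> 'b::euclidean_space" and g :: "'b \<Rightarrow> 'c::real_normed_vector"
  assumes S: "open S" and fST: "f ` S \<subseteq> T"
  shows "Ck_on k T g \<Longrightarrow> Ck_on k S f \<Longrightarrow> Ck_on k S (\<lambda>x. g (f x))"
proof (induction k arbitrary: g)
  case 0
  then show ?case using fST by (auto intro: continuous_on_compose2)
next
  case (Suc k)
  let ?f' = "\<lambda>x. frechet_derivative f (at x)" and ?g' = "\<lambda>x. frechet_derivative g (at x)"
  have f': "(f has_derivative ?f' x) (at x)" if "x \<in> S" for x
    using Ck_on_derivative[OF Suc.prems(2) that] .
  have g': "(g has_derivative ?g' (f x)) (at (f x))" if "x \<in> S" for x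
    using Ck_on_derivative[OF Suc.prems(1)] that fST by blast
  show ?case
  proof (rule Ck_on_SucI[OF S])
    fix x assume x: "x \<in> S"
    have D: "((\<lambda>x. g (f x)) has_derivative (\<lambda>v. ?g' (f x) (?f' x v))) (at x)"
      using diff_chain_at[OF f'[OF x] g'[OF x]] by (simp add: o_def)
    have eq: "?g' (f x) w = (\<Sum>b\<in>Basis. (w \<bullet> b) *\<^sub>R ?g' (f x) b)" for w
    proof -
      interpret linear "?g' (f x)" using g'[OF x] has_derivative_linear by blast
      have "?g' (f x) w = ?g' (f x) (\<Sum>b\<in>Basis. (w \<bullet> b) *\<^sub>R b)"
        by (simp add: euclidean_representation)
      then show ?thesis by (simp only: sum scale)
    qed
    show "((\<lambda>x. g (f x)) has_derivative
        (\<lambda>v. \<Sum>b\<in>Basis. (?f' x v \<bullet> b) *\<^sub>R ?g' (f x) b)) (at x)"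
      by (rule has_derivative_eq_rhs[OF D ext]) (rule eq)
  next
    fix v
    show "Ck_on k S (\<lambda>x. \<Sum>b\<in>Basis. (?f' x v \<bullet> b) *\<^sub>R ?g' (f x) b)"
    proof (intro Ck_on_sum S Ck_on_scaleR Ck_on_inner Ck_on_const)
      show "Ck_on k S (\<lambda>x. ?f' x v)" using Suc.prems(2) by simp
      show "Ck_on k S (\<lambda>x. ?g' (f x) b)" for b
        using Suc.IH[of "\<lambda>y. ?g' y b"] Suc.prems(1) Ck_on_SucD[OF Suc.prems(2)] by simp
    qed
  qed
qed

lemma Ck_on_vec_nth: "open S \<Longrightarrow> Ck_on k S f \<Longrightarrow> Ck_on k S (\<lambda>x. f x $ i)"
  using Ck_on_bounded_linear[OF bounded_linear_vec_nth] by blast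

lemma Ck_on_vec_lambda:
  fixes f :: "'a::euclidean_space \<Rightarrow> 'n::finite \<Rightarrow> real"
  assumes "open S" "\<And>i. Ck_on k S (\<lambda>x. f x i)"
  shows "Ck_on k S (\<lambda>x. \<chi> i. f x i)"
proof -
  have *: "(\<chi> i. f x i) = (\<Sum>i\<in>UNIV. f x i *\<^sub>R axis i 1)" for x
    by (simp add: vec_eq_iff axis_def if_distrib cong: if_cong)
  show ?thesis
    unfolding * by (intro Ck_on_sum Ck_on_scaleR Ck_on_const assms)
qed

lemma Ck_on_exp: "Ck_on k UNIV (exp :: real \<Rightarrow> real)"
proof (induction k)
  case (Suc k)
  show ?case
    by (rule Ck_on_SucI[where f' = "\<lambda>x v. exp x * v"])
      (auto intro!: derivative_eq_intros Ck_on_mult Ck_on_const Suc)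
qed (auto intro: continuous_intros)

lemma Ck_on_inverse: "Ck_on k (- {0}) (inverse :: real \<Rightarrow> real)"
proof (induction k)
  case (Suc k)
  have op: "open (- {0::real})" by auto
  have "(inverse has_derivative (\<lambda>v. - 1 * (inverse x * inverse x * v))) (at x)"
    if "x \<noteq> 0" for x :: real
    using that by (auto intro!: derivative_eq_intros)
  then show ?case
    by (intro Ck_on_SucI[where f' = "\<lambda>x v. - 1 * (inverse x * inverse x * v)"] Ck_on_mult
        Ck_on_const Suc op) auto
qed (auto intro: continuous_intros)

text \<open>By the Leibniz rule the derivative in direction \<open>v\<close> is an integral of the
  same form, whose integrand is the derivative of \<open>F\<close> in direction
  \<open>(0, v)\<close> and has order one less.\<close>

lemma Ck_on_integral:
  fixes F :: "real \<times> 'a::euclidean_space \<Rightarrow> real"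
  assumes "open S" "{0..1} \<times> S \<subseteq> W"
  shows "Ck_on k W F \<Longrightarrow> Ck_on k S (\<lambda>x. integral {0..1} (\<lambda>t. F (t, x)))"
proof (induction k arbitrary: F)
  case 0
  have "continuous_on (S \<times> cbox 0 1) (\<lambda>(x, t). F (t, x))"
    unfolding case_prod_unfold using 0 assms
    by (auto intro!: continuous_on_compose2[of W F] continuous_intros)
  then show ?case using integral_continuous_on_param[of S 0 1 "\<lambda>x t. F (t, x)"] by simp
next
  case (Suc k)
  let ?F' = "\<lambda>p. frechet_derivative F (at p)"
  have F': "(F has_derivative ?F' p) (at p)" if "p \<in> W" for p
    using Ck_on_derivative[OF Suc.prems that] .
  have cF': "continuous_on W (\<lambda>p. ?F' p v)" for v
    using Suc.prems Ck_on_imp_continuous_on[of k W "\<lambda>p. ?F' p v"] by (simp del: split_paired_All)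
  have cF: "continuous_on W F" using Suc.prems Ck_on_imp_continuous_on by blast
  \<comment> \<open>\<open>leibniz_rule\<close> wants the partial derivative as a continuous family
    of bounded linear maps. Off \<open>W\<close> the argument of \<open>Blinfun\<close> need not be
    linear, so \<open>fx\<close> is evaluated on \<open>W\<close> only.\<close>
  define fx where "fx = (\<lambda>x t. Blinfun (\<lambda>v. ?F' (t, x) (0, v)))"
  have lin: "bounded_linear (\<lambda>v. ?F' (t, x) (0, v))" if "(t, x) \<in> W" for t x
    using bounded_linear_compose[OF has_derivative_bounded_linear[OF F'[OF that]]
        bounded_linear_Pair[OF bounded_linear_zero bounded_linear_ident]] by (simp)
  have fx: "blinfun_apply (fx x t) v = ?F' (t, x) (0, v)" if "(t, x) \<in> W" for t x v
    unfolding fx_def using bounded_linear_Blinfun_apply[OF lin[OF that]] by simp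
  have W: "(t, x) \<in> W" if "t \<in> cbox 0 1" "x \<in> S" for t x
    using assms(2) that by auto
  show ?case
  proof (rule Ck_on_SucI[OF assms(1)])
    fix x assume x: "x \<in> S"
    \<comment> \<open>The Leibniz rule is applied on a convex set, hence on a ball inside
      \<open>S\<close>.\<close>
    then obtain r where r: "r > 0" "ball x r \<subseteq> S"
      using assms(1) open_contains_ball by blast
    have "((\<lambda>x. integral (cbox 0 1) (\<lambda>t. F (t, x))) has_derivative
        blinfun_apply (integral (cbox 0 1) (fx x))) (at x within ball x r)"
    proof (rule leibniz_rule)
      fix y t assume y: "y \<in> ball x r" and t: "t \<in> cbox 0 (1::real)"
      then have ty: "(t, y) \<in> W" using W r by blast
      have "((\<lambda>y. F (t, y)) has_derivative (\<lambda>v. ?F' (t, y) (0, v))) (at y)"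
        using diff_chain_at[OF has_derivative_Pair[OF has_derivative_const has_derivative_ident] F'[OF ty]]
        by (simp add: o_def)
      then have "((\<lambda>y. F (t, y)) has_derivative blinfun_apply (fx y t)) (at y)"
        by (rule has_derivative_eq_rhs) (simp add: fx[OF ty] fun_eq_iff)
      then show "((\<lambda>y. F (t, y)) has_derivative blinfun_apply (fx y t)) (at y within ball x r)"
        by (rule has_derivative_at_withinI)
    next
      fix y assume y: "y \<in> ball x r"
      show "(\<lambda>t. F (t, y)) integrable_on cbox 0 1"
        by (rule integrable_continuous, rule continuous_on_compose2[OF cF])
          (use y r W in \<open>auto intro!: continuous_intros\<close>)
    next
      show "continuous_on (ball x r \<times> cbox 0 1) (\<lambda>(x, t). fx x t)"
      proof (rule continuous_on_blinfun_componentwise)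
        fix i :: 'a
        have "continuous_on (ball x r \<times> cbox 0 1) (\<lambda>p. ?F' (snd p, fst p) (0, i))"
          by (rule continuous_on_compose2[OF cF'])
            (use r W in \<open>auto intro!: continuous_intros\<close>)
        then show "continuous_on (ball x r \<times> cbox 0 1) (\<lambda>p. blinfun_apply (case p of (x, t) \<Rightarrow> fx x t) i)"
          by (rule continuous_on_eq) (use fx r W in auto)
      qed
    qed (use r in auto)
    then have D: "((\<lambda>x. integral {0..1} (\<lambda>t. F (t, x))) has_derivative
        blinfun_apply (integral (cbox 0 1) (fx x))) (at x)"
      using r at_within_open[of x "ball x r"] by simp
    have cfx: "continuous_on (cbox 0 1) (fx x)"
    proof (rule continuous_on_blinfun_componentwise)
      fix i :: 'a
      have "continuous_on (cbox 0 1) (\<lambda>t. ?F' (t, x) (0, i))"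
        by (rule continuous_on_compose2[OF cF'])
          (use x W in \<open>auto intro!: continuous_intros\<close>)
      then show "continuous_on (cbox 0 1) (\<lambda>t. blinfun_apply (fx x t) i)"
        by (rule continuous_on_eq) (use fx x W in auto)
    qed
    have "blinfun_apply (integral (cbox 0 1) (fx x)) v = integral {0..1} (\<lambda>t. ?F' (t, x) (0, v))" for v
    proof -
      have "blinfun_apply (integral (cbox 0 1) (fx x)) v = integral (cbox 0 1) (\<lambda>t. blinfun_apply (fx x t) v)"
        using blinfun_apply_integral[OF integrable_continuous[OF cfx]] by blast
      also have "\<dots> = integral (cbox 0 1) (\<lambda>t. ?F' (t, x) (0, v))"
        by (rule integral_cong) (use fx x W in auto)
      finally show ?thesis by simp
    qed
    then show "((\<lambda>x. integral {0..1} (\<lambda>t. F (t, x))) has_derivative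
        (\<lambda>v. integral {0..1} (\<lambda>t. ?F' (t, x) (0, v)))) (at x)"
      by (intro has_derivative_eq_rhs[OF D] ext)
  next
    show "Ck_on k S (\<lambda>x. integral {0..1} (\<lambda>t. ?F' (t, x) (0, v)))" for v
      using Suc.IH[of "\<lambda>p. ?F' p (0, v)"] Suc.prems by (simp del: split_paired_All)
  qed
qed

section \<open>Closure properties of smooth functions\<close>

lemma smooth_on_derivative:
  "smooth_on S f \<Longrightarrow> x \<in> S \<Longrightarrow> (f has_derivative frechet_derivative f (at x)) (at x)"
  using Ck_on_derivative unfolding smooth_on_def by blast

lemma smooth_on_frechet: "smooth_on S f \<Longrightarrow> smooth_on S (\<lambda>x. frechet_derivative f (at x) v)"
  unfolding smooth_on_def by (metis Ck_on.simps(2))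

lemma smooth_on_imp_continuous_on: "smooth_on S f \<Longrightarrow> continuous_on S f"
  using Ck_on_imp_continuous_on unfolding smooth_on_def by blast

lemma smooth_on_cong:
  "smooth_on T f \<Longrightarrow> open S \<Longrightarrow> S \<subseteq> T \<Longrightarrow> (\<And>x. x \<in> S \<Longrightarrow> f x = g x) \<Longrightarrow> smooth_on S g"
  using Ck_on_cong unfolding smooth_on_def by blast

lemma smooth_on_subset: "smooth_on T f \<Longrightarrow> S \<subseteq> T \<Longrightarrow> smooth_on S f"
  using Ck_on_subset unfolding smooth_on_def by blast

lemma smooth_on_const: "smooth_on S (\<lambda>x. c)"
  using Ck_on_const unfolding smooth_on_def by blast

lemma smooth_on_id: "open S \<Longrightarrow> smooth_on S (\<lambda>x. x)"
  using Ck_on_id unfolding smooth_on_def by blast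

lemma smooth_on_add: "open S \<Longrightarrow> smooth_on S f \<Longrightarrow> smooth_on S g \<Longrightarrow> smooth_on S (\<lambda>x. f x + g x)"
  unfolding smooth_on_def by (simp add: Ck_on_add)

lemma smooth_on_sum:
  "open S \<Longrightarrow> (\<And>i. i \<in> I \<Longrightarrow> smooth_on S (f i)) \<Longrightarrow> smooth_on S (\<lambda>x. \<Sum>i\<in>I. f i x)"
  unfolding smooth_on_def by (simp add: Ck_on_sum)

lemma smooth_on_scaleR: "open S \<Longrightarrow> smooth_on S f \<Longrightarrow> smooth_on S g \<Longrightarrow> smooth_on S (\<lambda>x. f x *\<^sub>R g x)"
  unfolding smooth_on_def by (simp add: Ck_on_scaleR)

lemma smooth_on_mult:
  fixes f g :: "'a::euclidean_space \<Rightarrow> real"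
  shows "open S \<Longrightarrow> smooth_on S f \<Longrightarrow> smooth_on S g \<Longrightarrow> smooth_on S (\<lambda>x. f x * g x)"
  unfolding smooth_on_def by (simp add: Ck_on_mult)

lemma smooth_on_compose:
  fixes f :: "'a::euclidean_space \<Rightarrow> 'b::euclidean_space"
  shows "open S \<Longrightarrow> f ` S \<subseteq> T \<Longrightarrow> smooth_on T g \<Longrightarrow> smooth_on S f \<Longrightarrow> smooth_on S (\<lambda>x. g (f x))"
  unfolding smooth_on_def using Ck_on_compose[of S f T _ g] by simp

lemma smooth_on_inverse:
  fixes f :: "'a::euclidean_space \<Rightarrow> real"
  assumes "open S" "smooth_on S f" "\<And>x. x \<in> S \<Longrightarrow> f x \<noteq> 0"
  shows "smooth_on S (\<lambda>x. inverse (f x))"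
  using smooth_on_compose[OF assms(1), of f "- {0}" inverse] assms Ck_on_inverse
  by (fastforce simp: smooth_on_def image_subset_iff)

lemma smooth_on_vec_nth: "open S \<Longrightarrow> smooth_on S f \<Longrightarrow> smooth_on S (\<lambda>x. f x $ i)"
  unfolding smooth_on_def by (simp add: Ck_on_vec_nth)

lemma smooth_on_vec_lambda:
  fixes f :: "'a::euclidean_space \<Rightarrow> 'n::finite \<Rightarrow> real"
  shows "open S \<Longrightarrow> (\<And>i. smooth_on S (\<lambda>x. f x i)) \<Longrightarrow> smooth_on S (\<lambda>x. \<chi> i. f x i)"
  unfolding smooth_on_def by (simp add: Ck_on_vec_lambda)

section \<open>The theorem of Frobenius for a 1-form on Euclidean space\<close>

lemma quadratic_bound_imp_has_derivative:
  fixes f :: "'a::real_normed_vector \<Rightarrow> 'b::real_normed_vector"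
  assumes lin: "bounded_linear f'" and S: "open S" "x \<in> S"
    and bd: "\<And>y. y \<in> S \<Longrightarrow> norm (f y - f x - f' (y - x)) \<le> K * (norm (y - x))\<^sup>2"
  shows "(f has_derivative f') (at x)"
proof -
  have "(f has_derivative f') (at x within S)"
    unfolding has_derivative_within_alt
  proof (intro conjI lin allI impI)
    fix e :: real assume e: "e > 0"
    \<comment> \<open>The denominator \<open>\<bar>K\<bar> + 1\<close> is positive whatever the sign
      of \<open>K\<close>.\<close>
    show "\<exists>d>0. \<forall>y\<in>S. norm (y - x) < d \<longrightarrow> norm (f y - f x - f' (y - x)) \<le> e * norm (y - x)"
    proof (intro exI[of _ "e / (\<bar>K\<bar> + 1)"] conjI ballI impI)
      fix y assume y: "y \<in> S" "norm (y - x) < e / (\<bar>K\<bar> + 1)"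
      have "K * norm (y - x) \<le> (\<bar>K\<bar> + 1) * norm (y - x)"
        by (intro mult_right_mono) auto
      also have "\<dots> \<le> e" using y(2) by (simp add: field_simps)
      finally have "K * norm (y - x) * norm (y - x) \<le> e * norm (y - x)"
        by (rule mult_right_mono) simp
      then show "norm (f y - f x - f' (y - x)) \<le> e * norm (y - x)"
        using bd[OF y(1)] by (simp add: power2_eq_square algebra_simps)
    qed (use e in simp)
  qed
  then show ?thesis using S at_within_open by metis
qed

text \<open>For a Lipschitz constant below 1 on the unit interval, Gronwall's inequality needs no
  exponential: compare with the maximum of \<open>\<bar>y\<bar>\<close>.\<close>

lemma gronwall_small:
  fixes y :: "real \<Rightarrow> real"
  assumes der: "\<And>t. t \<in> {0..1} \<Longrightarrow> (y has_real_derivative y' t) (at t within {0..1})"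
    and bd: "\<And>t. t \<in> {0..1} \<Longrightarrow> \<bar>y' t\<bar> \<le> L * \<bar>y t\<bar> + C"
    and L: "0 \<le> L" "L < 1" and C: "0 \<le> C" and t: "s \<in> {0..1}" "t \<in> {0..1}"
  shows "\<bar>y t\<bar> \<le> (\<bar>y s\<bar> + C) / (1 - L)"
proof -
  have "continuous_on {0..1} y"
    using der DERIV_continuous_on by blast
  then have "continuous_on {0..1} (\<lambda>t. \<bar>y t\<bar>)" by (intro continuous_intros)
  then obtain m where m: "m \<in> {0..1}" "\<And>t. t \<in> {0..1} \<Longrightarrow> \<bar>y t\<bar> \<le> \<bar>y m\<bar>"
    using continuous_attains_sup[of "{0..1::real}" "\<lambda>t. \<bar>y t\<bar>"] by auto
  have "\<bar>y' t\<bar> \<le> L * \<bar>y m\<bar> + C" if "t \<in> {0..1}" for t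
    using bd[OF that] mult_left_mono[OF m(2)[OF that] L(1)] by linarith
  \<comment> \<open>Mean value estimate between \<open>s\<close> and the maximum point
    \<open>m\<close>, whose distance is at most 1. As \<open>s\<close> is any time in the interval,
    the bound works forwards and backwards in time.\<close>
  then have "norm (y m - y s) \<le> (L * \<bar>y m\<bar> + C) * norm (m - s)"
    by (intro field_differentiable_bound[OF _ der]) (use m t in auto)
  also have "\<dots> \<le> (L * \<bar>y m\<bar> + C) * 1"
    by (intro mult_left_mono) (use m t L C in auto)
  finally have "\<bar>y m\<bar> * (1 - L) \<le> \<bar>y s\<bar> + C" by (simp add: algebra_simps)
  then have "\<bar>y m\<bar> \<le> (\<bar>y s\<bar> + C) / (1 - L)" using L by (simp add: field_simps)
  then show ?thesis using m(2)[OF t(2)] by linarith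
qed

text \<open>Continuity of the derivative is available for one direction at a time, so the bounds for
  the basis vectors are added up. Convexity turns the resulting \<open>L\<close> into a Lipschitz
  constant as well.\<close>

lemma C1_bounds:
  fixes f :: "'a::euclidean_space \<Rightarrow> 'b::real_normed_vector"
  assumes f: "Ck_on (Suc 0) R f" and C: "compact C" "convex C" "C \<subseteq> R"
  obtains L where "0 \<le> L" "\<And>x v. x \<in> C \<Longrightarrow> norm (frechet_derivative f (at x) v) \<le> L * norm v"
    "\<And>x y. x \<in> C \<Longrightarrow> y \<in> C \<Longrightarrow> norm (f x - f y) \<le> L * norm (x - y)"
proof -
  let ?f' = "\<lambda>x. frechet_derivative f (at x)"
  have "\<exists>B. \<forall>x\<in>C. norm (?f' x b) \<le> B" for b
  proof -
    have "continuous_on C (\<lambda>x. ?f' x b)"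
      by (rule continuous_on_subset[OF _ C(3)]) (use f in simp)
    then have "bounded ((\<lambda>x. ?f' x b) ` C)"
      using C(1) compact_continuous_image compact_imp_bounded by blast
    then show ?thesis by (auto simp: bounded_iff)
  qed
  then obtain B where B: "\<And>b x. x \<in> C \<Longrightarrow> norm (?f' x b) \<le> B b" by metis
  define L where "L = (\<Sum>b\<in>(Basis::'a set). \<bar>B b\<bar>)"
  have L0: "0 \<le> L" unfolding L_def by (intro sum_nonneg) auto
  have f': "(f has_derivative ?f' x) (at x)" if "x \<in> C" for x
    using Ck_on_derivative[OF f] that C(3) by blast
  have L: "norm (?f' x v) \<le> L * norm v" if x: "x \<in> C" for x v
  proof -
    interpret linear "?f' x" using f'[OF x] has_derivative_linear by blast
    have "?f' x v = ?f' x (\<Sum>b\<in>Basis. (v \<bullet> b) *\<^sub>R b)"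
      by (simp add: euclidean_representation)
    also have "\<dots> = (\<Sum>b\<in>Basis. (v \<bullet> b) *\<^sub>R ?f' x b)" by (simp only: sum scale)
    also have "norm \<dots> \<le> (\<Sum>b\<in>Basis. norm v * \<bar>B b\<bar>)"
    proof (rule sum_norm_le)
      fix b :: 'a assume b: "b \<in> Basis"
      have "\<bar>v \<bullet> b\<bar> \<le> norm v" using Basis_le_norm[OF b] .
      moreover have "norm (?f' x b) \<le> \<bar>B b\<bar>" using B[OF x, of b] by linarith
      ultimately show "norm ((v \<bullet> b) *\<^sub>R ?f' x b) \<le> norm v * \<bar>B b\<bar>"
        unfolding norm_scaleR by (intro mult_mono) auto
    qed
    finally show ?thesis by (simp add: L_def sum_distrib_left mult.commute)
  qed
  have "norm (f x - f y) \<le> L * norm (x - y)" if "x \<in> C" "y \<in> C" for x y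
  proof (rule differentiable_bound[OF C(2)])
    show "onorm (?f' x) \<le> L" if "x \<in> C" for x
      using onorm_le L[OF that] by blast
  qed (use that f' has_derivative_at_withinI in blast)+
  with L0 L show ?thesis using that by blast
qed

text \<open>The previous lemma, applied to each partial derivative, makes the derivative Lipschitz
  on \<open>C\<close>. The mean value inequality along the segment then gives the quadratic
  remainder.\<close>

lemma C2_taylor_bound:
  fixes f :: "'a::euclidean_space \<Rightarrow> 'b::real_normed_vector"
  assumes f: "Ck_on 2 R f" and C: "compact C" "convex C" "C \<subseteq> R"
  obtains K where "0 \<le> K" "\<And>x y. x \<in> C \<Longrightarrow> y \<in> C \<Longrightarrow>
    norm (f y - f x - frechet_derivative f (at x) (y - x)) \<le> K * (norm (y - x))\<^sup>2"
proof -
  let ?f' = "\<lambda>x. frechet_derivative f (at x)"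
  have "Ck_on (Suc 0) R (\<lambda>x. ?f' x b)" for b
    using f by (simp add: numeral_2_eq_2)
  then have "\<exists>L\<ge>0. \<forall>x\<in>C. \<forall>y\<in>C. norm (?f' x b - ?f' y b) \<le> L * norm (x - y)" for b
    using C1_bounds[OF _ C] by metis
  then obtain B where B0: "\<And>b. 0 \<le> B b"
    and B: "\<And>b x y. x \<in> C \<Longrightarrow> y \<in> C \<Longrightarrow> norm (?f' x b - ?f' y b) \<le> B b * norm (x - y)" by metis
  define K where "K = (\<Sum>b\<in>(Basis::'a set). B b)"
  have K0: "0 \<le> K" unfolding K_def by (intro sum_nonneg B0)
  have f': "(f has_derivative ?f' x) (at x)" if "x \<in> C" for x
    using Ck_on_derivative[of 1] f that C(3) by (auto simp: numeral_2_eq_2)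
  have K: "norm (?f' x v - ?f' y v) \<le> K * norm (x - y) * norm v"
    if x: "x \<in> C" and y: "y \<in> C" for x y v
  proof -
    have "linear (\<lambda>v. ?f' x v - ?f' y v)"
      using f'[OF x] f'[OF y] has_derivative_linear linear_compose_sub by blast
    then interpret linear "\<lambda>v. ?f' x v - ?f' y v" .
    have "?f' x v - ?f' y v = ?f' x (\<Sum>b\<in>Basis. (v \<bullet> b) *\<^sub>R b) - ?f' y (\<Sum>b\<in>Basis. (v \<bullet> b) *\<^sub>R b)"
      by (simp add: euclidean_representation)
    also have "\<dots> = (\<Sum>b\<in>Basis. (v \<bullet> b) *\<^sub>R (?f' x b - ?f' y b))" by (simp only: sum scale)
    also have "norm \<dots> \<le> (\<Sum>b\<in>Basis. norm v * (B b * norm (x - y)))"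
    proof (rule sum_norm_le)
      fix b :: 'a assume b: "b \<in> Basis"
      show "norm ((v \<bullet> b) *\<^sub>R (?f' x b - ?f' y b)) \<le> norm v * (B b * norm (x - y))"
        unfolding norm_scaleR using B[OF x y] Basis_le_norm[OF b] by (intro mult_mono) auto
    qed
    finally show ?thesis by (simp add: K_def sum_distrib_left sum_distrib_right mult_ac)
  qed
  have "norm (f y - f x - ?f' x (y - x)) \<le> K * (norm (y - x))\<^sup>2" if x: "x \<in> C" and y: "y \<in> C" for x y
  proof -
    have seg: "closed_segment x y \<subseteq> C" using C(2) x y by (simp add: closed_segment_subset)
    \<comment> \<open>On the segment the derivative differs from the one at \<open>x\<close> by at
      most \<open>K * norm (y - x)\<close>, which supplies the second factor
      \<open>norm (y - x)\<close>.\<close>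
    have "norm (f y - f x - ?f' x (y - x)) \<le> norm (y - x) * (K * norm (y - x))"
    proof (rule differentiable_bound_linearization[where S = "closed_segment x y"])
      show "(f has_derivative ?f' z) (at z within closed_segment x y)" if "z \<in> closed_segment x y" for z
        using f' seg that has_derivative_at_withinI by blast
      show "onorm (?f' z - ?f' x) \<le> K * norm (y - x)" if z: "z \<in> closed_segment x y" for z
      proof (rule onorm_le)
        fix v
        have "norm (?f' z v - ?f' x v) \<le> K * norm (z - x) * norm v" using K seg z x by blast
        also have "\<dots> \<le> K * norm (y - x) * norm v"
          using segment_bound1[OF z] K0 by (intro mult_right_mono mult_left_mono) auto
        finally show "norm ((?f' z - ?f' x) v) \<le> K * norm (y - x) * norm v" by simp
      qed
      show "x + t *\<^sub>R (y - x) \<in> closed_segment x y" if "t \<in> {0..1}" for t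
        using that by (auto simp: in_segment algebra_simps intro!: exI[of _ t])
    qed auto
    then show ?thesis by (simp add: power2_eq_square mult_ac)
  qed
  with K0 show ?thesis using that by blast
qed

lemma derivative_nth_eq_0:
  assumes "(f has_derivative f') (at x)" "open S" "x \<in> S" "\<And>x. x \<in> S \<Longrightarrow> f x $ k = 0"
  shows "f' v $ k = (0::real)"
proof -
  have "((\<lambda>x. f x $ k) has_derivative (\<lambda>v. f' v $ k)) (at x)"
    using bounded_linear.has_derivative[OF bounded_linear_vec_nth assms(1)] .
  moreover have "((\<lambda>x. f x $ k) has_derivative (\<lambda>v. 0)) (at x)"
    using has_derivative_transform_within_open[OF has_derivative_const assms(2,3)] assms(4) by metis
  ultimately show ?thesis using has_derivative_unique by metis
qed

section \<open>Rays in the coordinates other than the transverse one\<close>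

definition repl :: "'n \<Rightarrow> real ^ 'n \<Rightarrow> real \<Rightarrow> real ^ 'n" where
  "repl k q z = q + (z - q $ k) *\<^sub>R axis k 1"

text \<open>A parameter \<open>q\<close> encodes two things: its components other than
  \<open>k\<close> are the end point of a ray, and component \<open>k\<close> is the initial value
  at the origin. Going back to time \<open>t\<close> on the ray scales the former and keeps the
  latter.\<close>

definition shrink :: "'n \<Rightarrow> real \<Rightarrow> real ^ 'n \<Rightarrow> real ^ 'n" where
  "shrink k t q = repl k (t *\<^sub>R q) (q $ k)"

lemma repl_nth: "repl k q z $ i = (if i = k then z else q $ i)"
  by (simp add: repl_def axis_def)

lemma shrink_nth: "shrink k t q $ i = (if i = k then q $ k else t * q $ i)"
  by (simp add: shrink_def repl_nth)

lemma shrink_1 [simp]: "shrink k 1 q = q" and shrink_nth_self [simp]: "shrink k t q $ k = q $ k"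
  by (simp_all add: vec_eq_iff shrink_nth)

lemma shrink_shrink: "shrink k s (shrink k t q) = shrink k (s * t) q"
  by (simp add: vec_eq_iff shrink_nth)

lemma repl_scaleR_shrink: "repl k (s *\<^sub>R shrink k t q) z = repl k ((s * t) *\<^sub>R q) z"
  by (simp add: vec_eq_iff shrink_nth repl_nth)

lemma repl_diff: "repl k p y - repl k q z = repl k (p - q) (y - z)"
  by (simp add: vec_eq_iff repl_nth)

lemma inner_repl: "a $ k = 0 \<Longrightarrow> repl k q z \<bullet> a = q \<bullet> a"
  by (simp add: repl_def inner_add_left inner_axis')

lemma continuous_on_repl [continuous_intros]:
  "continuous_on S f \<Longrightarrow> continuous_on S g \<Longrightarrow> continuous_on S (\<lambda>x. repl k (f x) (g x))"
  unfolding repl_def by (intro continuous_intros)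

lemma continuous_on_shrink [continuous_intros]:
  "continuous_on S f \<Longrightarrow> continuous_on S g \<Longrightarrow> continuous_on S (\<lambda>x. shrink k (f x) (g x))"
  unfolding shrink_def by (intro continuous_intros)

lemma shrink_in_cbox:
  fixes c :: "real ^ 'n"
  assumes "q \<in> cbox (- c) c" "t \<in> {0..1}"
  shows "shrink k t q \<in> cbox (- c) c"
proof -
  have "\<bar>t * q $ i\<bar> \<le> c $ i" for i
  proof -
    have "\<bar>q $ i\<bar> \<le> c $ i" using assms(1) by (auto simp: mem_box_cart abs_le_iff dest: spec[of _ i])
    moreover have "\<bar>t * q $ i\<bar> \<le> 1 * \<bar>q $ i\<bar>"
      unfolding abs_mult using assms(2) by (intro mult_right_mono) auto
    ultimately show ?thesis by linarith
  qed
  then show ?thesis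
    using assms(1) by (auto simp: mem_box_cart shrink_nth abs_le_iff minus_le_iff)
qed

lemma shrink_in_box:
  fixes c :: "real ^ 'n"
  assumes "q \<in> box (- c) c" "t \<in> {0..1}"
  shows "shrink k t q \<in> box (- c) c"
proof -
  have "\<bar>t * q $ i\<bar> < c $ i" for i
  proof -
    have "\<bar>q $ i\<bar> < c $ i" using assms(1) by (auto simp: mem_box_cart abs_less_iff dest: spec[of _ i])
    moreover have "\<bar>t * q $ i\<bar> \<le> 1 * \<bar>q $ i\<bar>"
      unfolding abs_mult using assms(2) by (intro mult_right_mono) auto
    ultimately show ?thesis by linarith
  qed
  then show ?thesis
    using assms(1) by (auto simp: mem_box_cart shrink_nth abs_less_iff minus_less_iff)
qed

text \<open>The ordinary differential equation along all rays at once: \<open>t \<mapsto> Z (shrink k t q)\<close> is to solve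
  the equation \<open>z' = q \<bullet> a (repl k (t q) z)\<close> with initial value \<open>q $ k\<close>. The fixed point lives on the
  whole space, the parameter \<open>q\<close> being clamped to the box.\<close>

lemma ray_equation_solvable:
  fixes a :: "real ^ 'n \<Rightarrow> real ^ 'n" and c :: "real ^ 'n"
  assumes lip: "\<And>x y. norm (a x - a y) \<le> L * norm (x - y)" and L: "0 \<le> L"
    and bd: "\<And>x. norm (a x) \<le> M" and c: "\<And>i. 0 \<le> c $ i"
    and small: "\<And>q. q \<in> cbox (- c) c \<Longrightarrow> norm q * L \<le> 1 / 4"
  obtains Z where "continuous_on (cbox (- c) c) Z"
    "\<And>q. q \<in> cbox (- c) c \<Longrightarrow>
       Z q = q $ k + integral {0..1} (\<lambda>t. q \<bullet> a (repl k (t *\<^sub>R q) (Z (shrink k t q))))"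
proof -
  define cl where "cl = clamp (- c) c"
  have cl_in: "cl q \<in> cbox (- c) c" for q
    unfolding cl_def by (rule clamp_in_interval)
      (use c in \<open>auto simp: Basis_vec_def inner_axis minus_le_iff intro: order_trans[of _ 0]\<close>)
  have cl_eq: "cl q = q" if "q \<in> cbox (- c) c" for q
    unfolding cl_def using that by simp
  have ccl: "continuous_on S cl" for S
    unfolding cl_def using clamp_continuous_on[OF continuous_on_id] by simp
  have ca: "continuous_on UNIV a"
    by (rule lipschitz_on_continuous_on[of L], rule lipschitz_onI)
      (use lip L in \<open>auto simp: dist_norm\<close>)
  \<comment> \<open>The unknown \<open>Y\<close> is the deviation from the initial value. On the
    box, \<open>Z q\<close> is recovered as \<open>q $ k + Y q\<close>.\<close>
  define J where "J = (\<lambda>Y q t. cl q \<bullet> a (repl k (t *\<^sub>R cl q) (cl q $ k + Y (shrink k t (cl q)))))"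
  define T where "T = (\<lambda>Y q. integral {0..1::real} (J Y q))"
  have cJ2: "continuous_on (UNIV \<times> cbox 0 1) (\<lambda>(q, t). J Y q t)" if Y: "continuous_on UNIV Y" for Y
    unfolding J_def case_prod_unfold
    by (intro continuous_intros continuous_on_compose2[OF ca] continuous_on_compose2[OF Y]
        continuous_on_compose2[OF ccl]) auto
  have cT: "continuous_on UNIV (T Y)" if Y: "continuous_on UNIV Y" for Y
    using integral_continuous_on_param[OF cJ2[OF Y]] unfolding T_def by simp
  have cJ: "continuous_on {0..1} (J Y q)" if Y: "continuous_on UNIV Y" for Y q
    unfolding J_def
    by (intro continuous_intros continuous_on_compose2[OF ca] continuous_on_compose2[OF Y]) auto
  have iJ: "J Y q integrable_on {0..1}" if Y: "continuous_on UNIV Y" for Y q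
    using cJ[OF Y] integrable_continuous_real by blast
  obtain D where D: "\<And>q. q \<in> cbox (- c) c \<Longrightarrow> norm q \<le> D"
    using bounded_cbox[of "- c" c] unfolding bounded_iff by blast
  have bT: "norm (T Y q) \<le> D * M" if Y: "continuous_on UNIV Y" for Y q
  proof -
    have "norm (J Y q t) \<le> D * M" for t
      unfolding J_def real_norm_def
      using Cauchy_Schwarz_ineq2 mult_mono[OF D[OF cl_in] bd] norm_ge_zero
      by (metis (no_types, opaque_lifting) D cl_in order_trans)
    then show ?thesis
      unfolding T_def using integral_bound[of 0 1 "J Y q" "D * M"] cJ[OF Y] by simp
  qed
  have TB: "T Y \<in> bcontfun" if Y: "continuous_on UNIV Y" for Y
    unfolding bcontfun_def bounded_iff using cT[OF Y] bT[OF Y] by auto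
  \<comment> \<open>The integral operator lifted to the complete metric space of bounded continuous
    functions.\<close>
  define TT where "TT = (\<lambda>Y. Bcontfun (T (apply_bcontfun Y)))"
  have TT: "apply_bcontfun (TT Y) = T (apply_bcontfun Y)" for Y
    unfolding TT_def by (intro Bcontfun_inverse TB) (auto intro: continuous_intros)
  \<comment> \<open>Changing \<open>Y\<close> moves the argument of \<open>a\<close> only in
    component \<open>k\<close>, by at most \<open>dist Y Y'\<close>. The factor
    \<open>norm q * L\<close>, at most 1/4, makes the operator a contraction.\<close>
  have "dist (TT Y) (TT Y') \<le> 1 / 4 * dist Y Y'" for Y Y'
  proof (rule dist_bound)
    fix q
    let ?J = "J (apply_bcontfun Y) q" and ?J' = "J (apply_bcontfun Y') q"
    have cY: "continuous_on UNIV (apply_bcontfun Y)" "continuous_on UNIV (apply_bcontfun Y')"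
      by (auto intro: continuous_intros)
    have "norm (?J t - ?J' t) \<le> 1 / 4 * dist Y Y'" for t
    proof -
      let ?p = "\<lambda>Y. repl k (t *\<^sub>R cl q) (cl q $ k + apply_bcontfun Y (shrink k t (cl q)))"
      have "?p Y - ?p Y' = (apply_bcontfun Y (shrink k t (cl q)) - apply_bcontfun Y' (shrink k t (cl q))) *\<^sub>R axis k 1"
        unfolding repl_diff by (simp add: repl_def)
      then have "norm (?p Y - ?p Y') = dist (apply_bcontfun Y (shrink k t (cl q))) (apply_bcontfun Y' (shrink k t (cl q)))"
        by (simp add: dist_norm)
      also have "\<dots> \<le> dist Y Y'" by (rule dist_bounded)
      finally have p: "norm (?p Y - ?p Y') \<le> dist Y Y'" .
      have "norm (?J t - ?J' t) = \<bar>cl q \<bullet> (a (?p Y) - a (?p Y'))\<bar>"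
        unfolding J_def by (simp add: inner_diff_right)
      also have "\<dots> \<le> norm (cl q) * norm (a (?p Y) - a (?p Y'))" by (rule Cauchy_Schwarz_ineq2)
      also have "\<dots> \<le> norm (cl q) * (L * dist Y Y')"
        using lip[of "?p Y" "?p Y'"] p L by (intro mult_left_mono order_trans[OF lip] mult_left_mono) auto
      also have "\<dots> \<le> 1 / 4 * dist Y Y'"
        using mult_right_mono[OF small[OF cl_in, of q], of "dist Y Y'"] by (simp add: mult_ac)
      finally show ?thesis .
    qed
    then have "norm (integral {0..1} (\<lambda>t. ?J t - ?J' t)) \<le> 1 / 4 * dist Y Y' * (1 - 0)"
      by (intro integral_bound continuous_intros cJ cY) auto
    then show "dist (apply_bcontfun (TT Y) q) (apply_bcontfun (TT Y') q) \<le> 1 / 4 * dist Y Y'"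
      unfolding TT T_def dist_norm using integral_diff[OF iJ[OF cY(1)] iJ[OF cY(2)]] by simp
  qed
  then have "\<exists>!Y. TT Y = Y"
    by (intro banach_fix_type[of "1 / 4"]) auto
  then obtain Y where "TT Y = Y" by blast
  then have Y: "apply_bcontfun Y q = T (apply_bcontfun Y) q" for q
    using TT by metis
  have cY: "continuous_on UNIV (apply_bcontfun Y)" by (auto intro: continuous_intros)
  show ?thesis
  proof (rule that[of "\<lambda>q. q $ k + apply_bcontfun Y q"])
    show "continuous_on (cbox (- c) c) (\<lambda>q. q $ k + apply_bcontfun Y q)"
      by (intro continuous_intros continuous_on_subset[OF cY]) auto
  next
    fix q assume q: "q \<in> cbox (- c) c"
    show "q $ k + apply_bcontfun Y q = q $ k +
      integral {0..1} (\<lambda>t. q \<bullet> a (repl k (t *\<^sub>R q) (shrink k t q $ k + apply_bcontfun Y (shrink k t q))))"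
      by (subst Y) (simp add: T_def J_def cl_eq[OF q])
  qed
qed


text \<open>\<open>\<alpha>\<close> gives the slopes of the leaves as graphs over the coordinates
  other than \<open>k\<close>. For \<open>i $ k = 0\<close> the vector
  \<open>i + (\<alpha> x \<bullet> i) *\<^sub>R axis k 1\<close> is the lift of \<open>i\<close> to
  the plane of the distribution, and \<open>integrability\<close> is the equality of mixed second
  derivatives along the graph. The estimates hold on \<open>C\<close>, which contains all solution
  curves. \<open>B\<close> is the set of parameters and \<open>Z\<close> solves the ray
  equation.\<close>

locale ray_solution =
  fixes k :: "'n::finite" and \<alpha> :: "real ^ 'n \<Rightarrow> real ^ 'n" and R C B :: "(real ^ 'n) set"
    and Z :: "real ^ 'n \<Rightarrow> real" and L K M :: real
  assumes open_R: "open R" and smooth: "smooth_on R \<alpha>"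
    and k_zero: "\<And>x. x \<in> R \<Longrightarrow> \<alpha> x $ k = 0"
    and integrability: "\<And>x i j. x \<in> R \<Longrightarrow> i $ k = 0 \<Longrightarrow> j $ k = 0 \<Longrightarrow>
      frechet_derivative \<alpha> (at x) (i + (\<alpha> x \<bullet> i) *\<^sub>R axis k 1) \<bullet> j =
      frechet_derivative \<alpha> (at x) (j + (\<alpha> x \<bullet> j) *\<^sub>R axis k 1) \<bullet> i"
    and C_sub: "C \<subseteq> R"
    and bound: "\<And>x. x \<in> C \<Longrightarrow> norm (\<alpha> x) \<le> M" and M: "0 \<le> M"
    and lip: "\<And>x y. x \<in> C \<Longrightarrow> y \<in> C \<Longrightarrow> norm (\<alpha> x - \<alpha> y) \<le> L * norm (x - y)"
    and der_bound: "\<And>x v. x \<in> C \<Longrightarrow> norm (frechet_derivative \<alpha> (at x) v) \<le> L * norm v"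
    and L: "0 \<le> L"
    and taylor: "\<And>x y. x \<in> C \<Longrightarrow> y \<in> C \<Longrightarrow>
      norm (\<alpha> y - \<alpha> x - frechet_derivative \<alpha> (at x) (y - x)) \<le> K * (norm (y - x))\<^sup>2"
    and K: "0 \<le> K"
    and open_B: "open B"
    and small: "\<And>q. q \<in> B \<Longrightarrow> norm q * L \<le> 1 / 4"
    and star: "\<And>q t. q \<in> B \<Longrightarrow> t \<in> {0..1} \<Longrightarrow> shrink k t q \<in> B"
    and cont_Z: "continuous_on B Z"
    and Z_eq: "\<And>q. q \<in> B \<Longrightarrow>
       Z q = q $ k + integral {0..1} (\<lambda>t. q \<bullet> \<alpha> (repl k (t *\<^sub>R q) (Z (shrink k t q))))"
    and in_C: "\<And>q t. q \<in> B \<Longrightarrow> t \<in> {0..1} \<Longrightarrow> repl k (t *\<^sub>R q) (Z (shrink k t q)) \<in> C"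
begin

section \<open>Solutions along single rays\<close>

abbreviation "\<alpha>' x \<equiv> frechet_derivative \<alpha> (at x)"

abbreviation e :: "real ^ 'n" where "e \<equiv> axis k 1"

text \<open>The solution along one ray as a function of time; \<open>pt\<close> below is the curve
  in the leaf that lies over this ray.\<close>

definition "z q t = Z (shrink k t q)"

definition "pt q t = repl k (t *\<^sub>R q) (z q t)"

text \<open>The value at time 1 of the solution, with initial value 1, of the equation linearised
  along the curve \<open>pt q\<close> in the transverse direction. The integrand is the coefficient
  of that scalar equation.\<close>

definition "W q = exp (integral {0..1} (\<lambda>t. q \<bullet> \<alpha>' (pt q t) e))"

lemma pt_in_C: "q \<in> B \<Longrightarrow> t \<in> {0..1} \<Longrightarrow> pt q t \<in> C"
  and pt_in_R: "q \<in> B \<Longrightarrow> t \<in> {0..1} \<Longrightarrow> pt q t \<in> R"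
  unfolding pt_def z_def using in_C C_sub by blast+

lemma pt_1: "pt q 1 = repl k q (Z q)"
  by (simp add: pt_def z_def)

lemma \<alpha>_derivative: "x \<in> R \<Longrightarrow> (\<alpha> has_derivative \<alpha>' x) (at x)"
  using smooth_on_derivative[OF smooth] .

lemma \<alpha>'_k_zero: "x \<in> R \<Longrightarrow> \<alpha>' x v $ k = 0"
  using derivative_nth_eq_0[OF \<alpha>_derivative open_R _ k_zero] by blast

lemma continuous_on_z: "q \<in> B \<Longrightarrow> continuous_on {0..1} (z q)"
  unfolding z_def
  by (rule continuous_on_compose2[OF cont_Z]) (auto intro!: continuous_intros star)

lemma continuous_on_pt: "q \<in> B \<Longrightarrow> continuous_on {0..1} (pt q)"
  unfolding pt_def by (intro continuous_intros continuous_on_z)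

lemma continuous_on_along_pt:
  assumes "q \<in> B" "smooth_on R F"
  shows "continuous_on {0..1} (\<lambda>t. F (pt q t))"
  using assms pt_in_R
  by (intro continuous_on_compose2[OF smooth_on_imp_continuous_on continuous_on_pt]) auto

lemma continuous_on_velocity: "q \<in> B \<Longrightarrow> continuous_on {0..1} (\<lambda>t. q \<bullet> \<alpha> (pt q t))"
  by (intro continuous_intros continuous_on_along_pt smooth)

text \<open>The equation for the shortened ray \<open>shrink k t q\<close> is an integral over the
  unit interval; substituting \<open>s * t\<close> makes it an integral up to \<open>t\<close>. The
  factor \<open>t\<close> comes from the scaled components, and component \<open>k\<close>, which is
  not scaled, drops out because \<open>\<alpha> x $ k = 0\<close>.\<close>

lemma z_integral:
  assumes q: "q \<in> B" and t: "t \<in> {0..1}"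
  shows "z q t = q $ k + integral {0..t} (\<lambda>t. q \<bullet> \<alpha> (pt q t))"
proof -
  define \<phi> where "\<phi> = (\<lambda>t. q \<bullet> \<alpha> (pt q t))"
  define F where "F = (\<lambda>t. integral {0..t} \<phi>)"
  have c\<phi>: "continuous_on {0..1} \<phi>"
    unfolding \<phi>_def using continuous_on_velocity[OF q] .
  have F': "(F has_real_derivative \<phi> s) (at s within {0..1})" if "s \<in> {0..1}" for s
    unfolding F_def using integral_has_real_derivative[OF c\<phi> that] .
  have "((\<lambda>s. F (s * t)) has_real_derivative t * \<phi> (s * t)) (at s within {0..1})"
    if s: "s \<in> {0..1}" for s
  proof -
    have st: "s * t \<in> {0..1}" "(\<lambda>s. s * t) ` {0..1} \<subseteq> {0..1}"
      using s t by (auto simp: mult_le_one)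
    have "((\<lambda>s. s * t) has_real_derivative t) (at s within {0..1})"
      by (auto intro!: derivative_eq_intros)
    from DERIV_image_chain[OF DERIV_subset[OF F'[OF st(1)] st(2)] this]
    show ?thesis by (simp add: o_def mult.commute)
  qed
  then have "((\<lambda>s. t * \<phi> (s * t)) has_integral F (1 * t) - F (0 * t)) {0..1}"
    by (intro fundamental_theorem_of_calculus) (auto simp: has_real_derivative_iff_has_vector_derivative)
  then have int: "integral {0..1} (\<lambda>s. t * \<phi> (s * t)) = F t"
    by (simp only: integral_unique) (simp add: F_def)
  have "z q t = q $ k + integral {0..1} (\<lambda>s. shrink k t q \<bullet>
      \<alpha> (repl k (s *\<^sub>R shrink k t q) (Z (shrink k s (shrink k t q)))))"
    using Z_eq[OF star[OF q t]] by (simp add: z_def)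
  also have "integral {0..1} (\<lambda>s. shrink k t q \<bullet>
      \<alpha> (repl k (s *\<^sub>R shrink k t q) (Z (shrink k s (shrink k t q))))) =
      integral {0..1} (\<lambda>s. t * \<phi> (s * t))"
  proof (rule integral_cong)
    fix s :: real assume s: "s \<in> {0..1}"
    then have st: "s * t \<in> {0..1}" using t by (auto simp: mult_le_one)
    have "shrink k t q \<bullet> \<alpha> (pt q (s * t)) = t * (q \<bullet> \<alpha> (pt q (s * t)))"
      unfolding shrink_def by (subst inner_repl[OF k_zero[OF pt_in_R[OF q st]]]) simp
    then show "shrink k t q \<bullet> \<alpha> (repl k (s *\<^sub>R shrink k t q) (Z (shrink k s (shrink k t q))))
        = t * \<phi> (s * t)"
      by (simp add: \<phi>_def pt_def z_def shrink_shrink repl_scaleR_shrink)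
  qed
  finally show ?thesis using int by (simp add: F_def \<phi>_def)
qed

lemma z_0: "q \<in> B \<Longrightarrow> z q 0 = q $ k"
  by (simp add: z_integral)

lemma z_derivative:
  assumes q: "q \<in> B" and t: "t \<in> {0..1}"
  shows "(z q has_real_derivative q \<bullet> \<alpha> (pt q t)) (at t within {0..1})"
proof -
  have "((\<lambda>t. q $ k + integral {0..t} (\<lambda>t. q \<bullet> \<alpha> (pt q t))) has_real_derivative 0 + q \<bullet> \<alpha> (pt q t))
      (at t within {0..1})"
    by (intro DERIV_add DERIV_const integral_has_real_derivative[OF continuous_on_velocity[OF q] t])
  then show ?thesis
    using has_field_derivative_transform_within[OF _ zero_less_one t, of _ _ "z q"] z_integral[OF q] by simp
qed

text \<open>The difference \<open>D\<close> of two solutions is compared with a solution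
  \<open>v\<close> of the linearised equation. Their difference \<open>X\<close> starts at 0, and
  its derivative is bounded by \<open>\<bar>X\<bar> / 4\<close> plus a term quadratic in
  \<open>q' - q\<close>, so Gronwall bounds it quadratically at time 1. The constant may depend on
  \<open>q\<close>, but not on \<open>q'\<close>.\<close>

lemma Z_quadratic_bound:
  assumes q: "q \<in> B"
  shows "\<exists>K'. \<forall>q'\<in>B. norm (Z q' - Z q - (\<alpha> (repl k q (Z q)) \<bullet> (q' - q) + W q * (q' - q) $ k))
    \<le> K' * (norm (q' - q))\<^sup>2"
proof -
  \<comment> \<open>\<open>c\<close> is the Gronwall constant in
    \<open>\<bar>D t\<bar> \<le> c * norm h\<close>: the initial difference contributes 1 and the
    inhomogeneous term \<open>M + 1 / 2\<close>. \<open>K'\<close> is the Gronwall constant for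
    \<open>X\<close>, where the two summands bound the terms \<open>?r1\<close> and
    \<open>?r2\<close> below.\<close>
  define c where "c = (M + 3 / 2) / (1 - 1 / 4)"
  define K' where "K' = (L * (2 + c) + norm q * (K * (2 + c)\<^sup>2)) / (1 - 1 / 4)"
  have c: "0 \<le> c" using M by (simp add: c_def)
  have nq: "norm q * L \<le> 1 / 4" using small[OF q] .
  have "norm (Z q' - Z q - (\<alpha> (repl k q (Z q)) \<bullet> (q' - q) + W q * (q' - q) $ k))
    \<le> K' * (norm (q' - q))\<^sup>2" if q': "q' \<in> B" for q'
  proof -
    define h where "h = q' - q"
    have q'h: "q' = q + h" by (simp add: h_def)
    define D where "D = (\<lambda>t. z q' t - z q t)"
    have hk: "\<bar>h $ k\<bar> \<le> norm h" by (rule component_le_norm_cart)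
    have pd: "pt q' t - pt q t = t *\<^sub>R h + (D t - t * h $ k) *\<^sub>R e" for t
      unfolding pt_def repl_diff by (simp add: repl_def D_def h_def algebra_simps)
    have npd: "norm (pt q' t - pt q t) \<le> 2 * norm h + \<bar>D t\<bar>" if t: "t \<in> {0..1}" for t
    proof -
      have "norm (t *\<^sub>R h) \<le> norm h" "\<bar>t * h $ k\<bar> \<le> norm h"
        using t mult_mono[of "\<bar>t\<bar>" 1 "norm h" "norm h"] mult_mono[of "\<bar>t\<bar>" 1 "\<bar>h $ k\<bar>" "norm h"] hk
        by (auto simp: abs_mult)
      moreover have "norm ((D t - t * h $ k) *\<^sub>R e) \<le> \<bar>D t\<bar> + \<bar>t * h $ k\<bar>" by simp
      ultimately show ?thesis
        unfolding pd using norm_triangle_ineq[of "t *\<^sub>R h" "(D t - t * h $ k) *\<^sub>R e"] by linarith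
    qed
    have D': "(D has_real_derivative q' \<bullet> \<alpha> (pt q' t) - q \<bullet> \<alpha> (pt q t)) (at t within {0..1})"
      if t: "t \<in> {0..1}" for t
      unfolding D_def by (intro derivative_intros z_derivative q q' t)
    have D'_eq: "q' \<bullet> \<alpha> (pt q' t) - q \<bullet> \<alpha> (pt q t) = h \<bullet> \<alpha> (pt q' t) + q \<bullet> (\<alpha> (pt q' t) - \<alpha> (pt q t))" for t
      by (simp add: q'h inner_simps)
    have D: "\<bar>D t\<bar> \<le> c * norm h" if t: "t \<in> {0..1}" for t
    proof -
      have "\<bar>q' \<bullet> \<alpha> (pt q' s) - q \<bullet> \<alpha> (pt q s)\<bar> \<le> 1 / 4 * \<bar>D s\<bar> + (M + 1 / 2) * norm h"
        if s: "s \<in> {0..1}" for s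
      proof -
        have "\<bar>h \<bullet> \<alpha> (pt q' s)\<bar> \<le> norm h * M"
          using Cauchy_Schwarz_ineq2[of h "\<alpha> (pt q' s)"] mult_left_mono[OF bound[OF pt_in_C[OF q' s]], of "norm h"]
          by simp
        moreover have "\<bar>q \<bullet> (\<alpha> (pt q' s) - \<alpha> (pt q s))\<bar> \<le> 1 / 4 * (2 * norm h + \<bar>D s\<bar>)"
        proof -
          have "\<bar>q \<bullet> (\<alpha> (pt q' s) - \<alpha> (pt q s))\<bar> \<le> norm q * (L * norm (pt q' s - pt q s))"
            by (rule order_trans[OF Cauchy_Schwarz_ineq2 mult_left_mono[OF lip[OF pt_in_C pt_in_C]]])
              (use q q' s in auto)
          also have "\<dots> \<le> 1 / 4 * norm (pt q' s - pt q s)"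
            using mult_right_mono[OF nq, of "norm (pt q' s - pt q s)"] by (simp add: mult_ac)
          also have "\<dots> \<le> 1 / 4 * (2 * norm h + \<bar>D s\<bar>)"
            using npd[OF s] by simp
          finally show ?thesis .
        qed
        ultimately show ?thesis unfolding D'_eq by (simp add: algebra_simps)
      qed
      from gronwall_small[OF D' this _ _ _ _ t, of 0]
      have "\<bar>D t\<bar> \<le> (\<bar>D 0\<bar> + (M + 1 / 2) * norm h) / (1 - 1 / 4)" using M by simp
      also have "\<dots> \<le> (norm h + (M + 1 / 2) * norm h) / (1 - 1 / 4)"
        using hk z_0[OF q] z_0[OF q'] by (intro divide_right_mono add_right_mono) (auto simp: D_def h_def)
      also have "\<dots> = c * norm h" by (simp add: c_def field_simps)
      finally show ?thesis .
    qed
    have npd': "norm (pt q' t - pt q t) \<le> (2 + c) * norm h" if t: "t \<in> {0..1}" for t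
      using npd[OF t] D[OF t] by (simp add: algebra_simps)
    define l where "l = (\<lambda>t. q \<bullet> \<alpha>' (pt q t) e)"
    define E where "E = (\<lambda>t. exp (integral {0..t} l))"
    \<comment> \<open>The candidate for the linearisation: \<open>\<alpha> \<bullet> h\<close> is
      scaled by \<open>t\<close> because the ray moves by \<open>t *\<^sub>R h\<close> at time
      \<open>t\<close>, and \<open>E\<close> transports the change \<open>h $ k\<close> of the
      initial value.\<close>
    define v where "v = (\<lambda>t. t * (\<alpha> (pt q t) \<bullet> h) + E t * h $ k)"
    define X where "X = (\<lambda>t. D t - v t)"
    have cl: "continuous_on {0..1} l"
      unfolding l_def by (intro continuous_intros continuous_on_along_pt q smooth_on_frechet smooth)
    have l_le: "\<bar>l t\<bar> \<le> 1 / 4" if t: "t \<in> {0..1}" for t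
    proof -
      have "\<bar>l t\<bar> \<le> norm q * norm (\<alpha>' (pt q t) e)"
        unfolding l_def by (rule Cauchy_Schwarz_ineq2)
      also have "\<dots> \<le> norm q * L"
        using der_bound[OF pt_in_C[OF q t], of e] by (intro mult_left_mono) auto
      finally show ?thesis using nq by linarith
    qed
    \<comment> \<open>This is the linearised equation: the right-hand side is
      \<open>\<alpha> \<bullet> h\<close> plus the derivative of \<open>q \<bullet> \<alpha>\<close>
      in direction \<open>t *\<^sub>R h + (v t - t * h $ k) *\<^sub>R e\<close>, which is the
      displacement of \<open>pt\<close> to first order.\<close>
    have v': "(v has_real_derivative
        \<alpha> (pt q t) \<bullet> h + t * (q \<bullet> \<alpha>' (pt q t) h) - t * h $ k * l t + l t * v t) (at t within {0..1})"
      if t: "t \<in> {0..1}" for t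
    proof -
      let ?p = "pt q t"
      have R: "?p \<in> R" using pt_in_R[OF q t] .
      interpret \<alpha>': linear "\<alpha>' ?p" using \<alpha>_derivative[OF R] has_derivative_linear by blast
      let ?pdot = "q + (q \<bullet> \<alpha> ?p - q $ k) *\<^sub>R e"
      have pt_eq: "pt q = (\<lambda>t. t *\<^sub>R q + (z q t - t * q $ k) *\<^sub>R e)"
        by (simp add: pt_def repl_def fun_eq_iff)
      have "((\<lambda>t. t *\<^sub>R q + (z q t - t * q $ k) *\<^sub>R e) has_derivative (\<lambda>s. s *\<^sub>R ?pdot))
          (at t within {0..1})"
        by (rule has_derivative_eq_rhs, (rule derivative_intros z_derivative[OF q t, unfolded has_field_derivative_def])+)
          (simp add: fun_eq_iff algebra_simps)
      then have "(pt q has_derivative (\<lambda>s. s *\<^sub>R ?pdot)) (at t within {0..1})"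
        by (simp only: pt_eq[symmetric])
      from has_derivative_compose[OF this \<alpha>_derivative[OF R]]
      have "((\<lambda>t. \<alpha> (pt q t)) has_derivative (\<lambda>s. s *\<^sub>R \<alpha>' ?p ?pdot)) (at t within {0..1})"
        by (simp only: \<alpha>'.scale)
      then have "((\<lambda>t. \<alpha> (pt q t) \<bullet> h) has_derivative (\<lambda>s. s *\<^sub>R \<alpha>' ?p ?pdot \<bullet> h)) (at t within {0..1})"
        by (rule bounded_linear.has_derivative[OF bounded_linear_inner_left])
      then have a: "((\<lambda>t. \<alpha> (pt q t) \<bullet> h) has_real_derivative \<alpha>' ?p ?pdot \<bullet> h) (at t within {0..1})"
        by (simp add: has_field_derivative_def mult.commute[of _ "_ \<bullet> h"] mult_commute_abs)
      have E: "(E has_real_derivative E t * l t) (at t within {0..1})"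
        unfolding E_def by (rule DERIV_chain2[OF DERIV_exp integral_has_real_derivative[OF cl t]])
      \<comment> \<open>Integrability exchanges the roles of \<open>q\<close> and \<open>h\<close>.
        It is applied to both vectors with component \<open>k\<close> removed, which changes none of
        the inner products because \<open>\<alpha>\<close> and its derivative have vanishing
        component \<open>k\<close>.\<close>
      have "\<alpha>' ?p ?pdot \<bullet> h = \<alpha>' ?p (h + (\<alpha> ?p \<bullet> h - h $ k) *\<^sub>R e) \<bullet> q"
      proof -
        let ?i = "h - (h $ k) *\<^sub>R e" and ?j = "q - (q $ k) *\<^sub>R e"
        have k0: "\<alpha> ?p $ k = 0" "\<And>v. \<alpha>' ?p v $ k = 0" using R k_zero \<alpha>'_k_zero by auto
        have "\<alpha>' ?p (?i + (\<alpha> ?p \<bullet> ?i) *\<^sub>R e) \<bullet> ?j = \<alpha>' ?p (?j + (\<alpha> ?p \<bullet> ?j) *\<^sub>R e) \<bullet> ?i"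
          by (rule integrability[OF R]) auto
        moreover have "\<alpha> ?p \<bullet> ?i = \<alpha> ?p \<bullet> h" "\<alpha> ?p \<bullet> ?j = q \<bullet> \<alpha> ?p"
          "\<And>v. \<alpha>' ?p v \<bullet> ?i = \<alpha>' ?p v \<bullet> h" "\<And>v. \<alpha>' ?p v \<bullet> ?j = \<alpha>' ?p v \<bullet> q"
          using k0 by (simp_all add: inner_diff_right inner_axis inner_commute[of q])
        moreover have "?i + a *\<^sub>R e = h + (a - h $ k) *\<^sub>R e" "?j + a *\<^sub>R e = q + (a - q $ k) *\<^sub>R e" for a
          by (simp_all add: algebra_simps)
        ultimately show ?thesis by (simp only:)
      qed
      also have "\<dots> = q \<bullet> \<alpha>' ?p h + (\<alpha> ?p \<bullet> h - h $ k) * l t"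
        by (simp add: \<alpha>'.add \<alpha>'.scale inner_add_left l_def inner_commute[of _ q] inner_add_right)
      finally have rhs: "\<alpha>' ?p ?pdot \<bullet> h = q \<bullet> \<alpha>' ?p h + (\<alpha> ?p \<bullet> h - h $ k) * l t" .
      show ?thesis
        unfolding v_def
        by (rule derivative_eq_intros a[unfolded rhs] E refl)+ (simp add: algebra_simps)
    qed
    have X': "(X has_real_derivative (q' \<bullet> \<alpha> (pt q' t) - q \<bullet> \<alpha> (pt q t)) -
        (\<alpha> (pt q t) \<bullet> h + t * (q \<bullet> \<alpha>' (pt q t) h) - t * h $ k * l t + l t * v t)) (at t within {0..1})"
      if t: "t \<in> {0..1}" for t
      unfolding X_def by (intro derivative_intros D' v' t)
    have X'_le: "\<bar>(q' \<bullet> \<alpha> (pt q' t) - q \<bullet> \<alpha> (pt q t)) -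
        (\<alpha> (pt q t) \<bullet> h + t * (q \<bullet> \<alpha>' (pt q t) h) - t * h $ k * l t + l t * v t)\<bar>
        \<le> 1 / 4 * \<bar>X t\<bar> + (L * (2 + c) + norm q * (K * (2 + c)\<^sup>2)) * (norm h)\<^sup>2"
      if t: "t \<in> {0..1}" for t
    proof -
      let ?p = "pt q t" and ?p' = "pt q' t"
      have R: "?p \<in> R" using pt_in_R[OF q t] .
      interpret \<alpha>': linear "\<alpha>' ?p" using \<alpha>_derivative[OF R] has_derivative_linear by blast
      \<comment> \<open>Both remainders are of second order in \<open>h\<close>: \<open>?r1\<close>
        is a product of two first-order quantities, and \<open>?r2\<close> is the Taylor remainder
        of \<open>\<alpha>\<close> paired with \<open>q\<close>.\<close>
      let ?r1 = "h \<bullet> (\<alpha> ?p' - \<alpha> ?p)" and ?r2 = "q \<bullet> (\<alpha> ?p' - \<alpha> ?p - \<alpha>' ?p (?p' - ?p))"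
      have "q \<bullet> \<alpha>' ?p (?p' - ?p) = t * (q \<bullet> \<alpha>' ?p h) + (D t - t * h $ k) * l t"
        unfolding pd by (simp add: \<alpha>'.add \<alpha>'.scale inner_add_right l_def)
      then have eq: "(q' \<bullet> \<alpha> ?p' - q \<bullet> \<alpha> ?p) -
        (\<alpha> ?p \<bullet> h + t * (q \<bullet> \<alpha>' ?p h) - t * h $ k * l t + l t * v t) = ?r1 + ?r2 + l t * X t"
        unfolding D'_eq X_def by (simp add: inner_diff_right inner_commute algebra_simps)
      have "\<bar>?r1\<bar> \<le> norm h * (L * ((2 + c) * norm h))"
        by (rule order_trans[OF Cauchy_Schwarz_ineq2])
          (rule mult_left_mono[OF order_trans[OF lip[OF pt_in_C[OF q' t] pt_in_C[OF q t]]
            mult_left_mono[OF npd'[OF t] L]] norm_ge_zero])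
      moreover have "\<bar>?r2\<bar> \<le> norm q * (K * ((2 + c) * norm h)\<^sup>2)"
        by (rule order_trans[OF Cauchy_Schwarz_ineq2])
          (rule mult_left_mono[OF order_trans[OF taylor[OF pt_in_C[OF q t] pt_in_C[OF q' t]]
            mult_left_mono[OF power_mono[OF npd'[OF t] norm_ge_zero] K]] norm_ge_zero])
      moreover have "\<bar>l t * X t\<bar> \<le> 1 / 4 * \<bar>X t\<bar>"
        unfolding abs_mult by (intro mult_right_mono l_le t) auto
      ultimately have "\<bar>?r1 + ?r2 + l t * X t\<bar> \<le> norm h * (L * ((2 + c) * norm h)) +
          norm q * (K * ((2 + c) * norm h)\<^sup>2) + 1 / 4 * \<bar>X t\<bar>" by linarith
      also have "\<dots> = 1 / 4 * \<bar>X t\<bar> + (L * (2 + c) + norm q * (K * (2 + c)\<^sup>2)) * (norm h)\<^sup>2"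
        by (simp add: power2_eq_square algebra_simps)
      finally show ?thesis unfolding eq .
    qed
    have "0 \<le> (L * (2 + c) + norm q * (K * (2 + c)\<^sup>2)) * (norm h)\<^sup>2"
      using L c K by simp
    from gronwall_small[OF X' X'_le _ _ this, of 0 1]
    have "\<bar>X 1\<bar> \<le> (\<bar>X 0\<bar> + (L * (2 + c) + norm q * (K * (2 + c)\<^sup>2)) * (norm h)\<^sup>2) / (1 - 1 / 4)"
      by simp
    moreover have "X 0 = 0"
      using z_0[OF q] z_0[OF q'] by (simp add: X_def D_def v_def E_def h_def)
    ultimately have "\<bar>X 1\<bar> \<le> K' * (norm h)\<^sup>2" by (simp add: K'_def algebra_simps)
    moreover have "X 1 = Z q' - Z q - (\<alpha> (repl k q (Z q)) \<bullet> h + W q * h $ k)"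
      by (simp add: X_def D_def v_def E_def W_def l_def pt_1 z_def)
    ultimately show ?thesis by (simp add: h_def)
  qed
  then show ?thesis by blast
qed

lemma Z_derivative:
  assumes q: "q \<in> B"
  shows "(Z has_derivative (\<lambda>h. \<alpha> (repl k q (Z q)) \<bullet> h + W q * h $ k)) (at q)"
proof -
  obtain K' where "\<And>q'. q' \<in> B \<Longrightarrow> norm (Z q' - Z q - (\<alpha> (repl k q (Z q)) \<bullet> (q' - q) + W q * (q' - q) $ k))
    \<le> K' * (norm (q' - q))\<^sup>2"
    using Z_quadratic_bound[OF q] by blast
  moreover have "bounded_linear (\<lambda>h. \<alpha> (repl k q (Z q)) \<bullet> h + W q * h $ k)"
    by (intro bounded_linear_add bounded_linear_inner_right bounded_linear_const_mult bounded_linear_vec_nth)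
  ultimately show ?thesis
    using quadratic_bound_imp_has_derivative[OF _ open_B q] by blast
qed

section \<open>Smoothness of the solution in its parameter\<close>

lemma Ck_on_repl:
  assumes "open S" "Ck_on m S f" "Ck_on m S g"
  shows "Ck_on m S (\<lambda>x. repl j (f x) (g x))"
proof -
  have "repl j (f x) (g x) = f x + (g x + (- 1) * f x $ j) *\<^sub>R axis j 1" for x
    by (simp add: repl_def)
  then show ?thesis
    by (simp only:) (intro Ck_on_add Ck_on_scaleR Ck_on_mult Ck_on_vec_nth Ck_on_const assms)
qed

text \<open>\<open>W\<close> is the exponential of a parameter integral in which \<open>Z\<close>
  occurs undifferentiated, so it inherits the order of \<open>Z\<close>. This closes the bootstrap
  for \<open>Z\<close>.\<close>

lemma Ck_on_W:
  assumes Z: "Ck_on m B Z"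
  shows "Ck_on m B W"
proof -
  define P where "P = (\<lambda>p. pt (snd p) (fst p))"
  \<comment> \<open>Differentiating the integrand also in \<open>t\<close> takes an open set of
    pairs that reaches beyond the unit interval. \<open>O1\<close> keeps the shrunken parameter in
    \<open>B\<close>, and \<open>O2\<close> keeps the curve in \<open>R\<close>.\<close>
  define O1 where "O1 = {p \<in> UNIV \<times> B. shrink k (fst p) (snd p) \<in> B}"
  define O2 where "O2 = {p \<in> O1. P p \<in> R}"
  have "O1 = UNIV \<times> B \<inter> (\<lambda>p. shrink k (fst p) (snd p)) -` B" by (auto simp: O1_def)
  moreover have "open \<dots>"
    by (intro continuous_open_preimage continuous_intros open_Times open_UNIV open_B)
  ultimately have op1: "open O1" by simp
  have sh: "Ck_on m O1 (\<lambda>p. shrink k (fst p) (snd p))"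
    unfolding shrink_def
    by (intro Ck_on_repl Ck_on_scaleR Ck_on_vec_nth Ck_on_bounded_linear[OF bounded_linear_fst]
        Ck_on_bounded_linear[OF bounded_linear_snd] Ck_on_id op1)
  have CP: "Ck_on m O1 P"
    unfolding P_def pt_def z_def
    by (intro Ck_on_repl Ck_on_scaleR Ck_on_bounded_linear[OF bounded_linear_fst]
        Ck_on_bounded_linear[OF bounded_linear_snd] Ck_on_id op1 Ck_on_compose[OF op1 _ Z sh])
      (auto simp: O1_def)
  have "O2 = O1 \<inter> P -` R" by (auto simp: O2_def)
  then have op2: "open O2"
    using continuous_open_preimage[OF Ck_on_imp_continuous_on[OF CP] op1 open_R] by simp
  have \<alpha>'e: "Ck_on m R (\<lambda>x. \<alpha>' x e)"
    using smooth_on_frechet[OF smooth] by (simp add: smooth_on_def)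
  have "Ck_on m O2 (\<lambda>p. \<alpha>' (P p) e)"
    by (rule Ck_on_compose[OF op2 _ \<alpha>'e Ck_on_subset[OF CP]]) (auto simp: O2_def)
  then have "Ck_on m O2 (\<lambda>p. snd p \<bullet> \<alpha>' (P p) e)"
    by (intro Ck_on_inner op2 Ck_on_bounded_linear[OF bounded_linear_snd] Ck_on_id)
  moreover have "{0..1} \<times> B \<subseteq> O2"
    using star pt_in_R by (auto simp: O1_def O2_def P_def)
  ultimately have "Ck_on m B (\<lambda>q. integral {0..1} (\<lambda>t. q \<bullet> \<alpha>' (pt q t) e))"
    using Ck_on_integral[OF open_B, of O2 m "\<lambda>p. snd p \<bullet> \<alpha>' (P p) e"] by (simp add: P_def)
  then show ?thesis
    unfolding W_def using Ck_on_compose[OF open_B _ Ck_on_exp] by simp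
qed

text \<open>The straightening map: slices of \<open>B\<close> with constant component
  \<open>k\<close>, that is with a fixed initial value, are carried into leaves.\<close>

definition "\<Psi> q = repl k q (Z q)"

lemma \<Psi>_in_C: "q \<in> B \<Longrightarrow> \<Psi> q \<in> C"
  using pt_in_C[of q 1] by (simp add: pt_1 \<Psi>_def)

lemma \<Psi>_in_R: "q \<in> B \<Longrightarrow> \<Psi> q \<in> R"
  using \<Psi>_in_C C_sub by blast

lemma Ck_on_Z: "Ck_on m B Z"
proof (induction m)
  case (Suc m)
  have \<Psi>: "Ck_on m B \<Psi>" unfolding \<Psi>_def by (intro Ck_on_repl open_B Ck_on_id Suc)
  have "Ck_on m B (\<lambda>q. \<alpha> (\<Psi> q))"
    using Ck_on_compose[OF open_B _ _ \<Psi>, of R \<alpha>] \<Psi>_in_R smooth by (auto simp: smooth_on_def)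
  then have D: "Ck_on m B (\<lambda>q. \<alpha> (repl k q (Z q)) \<bullet> v + W q * v $ k)" for v
    by (intro Ck_on_add Ck_on_mult Ck_on_inner Ck_on_const open_B Ck_on_W Suc) (simp add: \<Psi>_def)
  show ?case
    by (rule Ck_on_SucI[OF open_B Z_derivative D])
qed (use cont_Z in simp)

lemma Ck_on_\<Psi>: "Ck_on m B \<Psi>"
  unfolding \<Psi>_def by (intro Ck_on_repl open_B Ck_on_id Ck_on_Z)

text \<open>Uniqueness backwards in time: equal images mean two solutions over the same ray with
  equal values at time 1. Gronwall from time 1 down to time 0 makes the initial values
  agree.\<close>

lemma inj_on_\<Psi>: "inj_on \<Psi> B"
proof (rule inj_onI)
  fix q q' assume q: "q \<in> B" and q': "q' \<in> B" and eq: "\<Psi> q = \<Psi> q'"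
  have i: "q $ i = q' $ i" if "i \<noteq> k" for i
    using arg_cong[OF eq, of "\<lambda>x. x $ i"] that by (simp add: \<Psi>_def repl_nth)
  have Z: "Z q = Z q'"
    using arg_cong[OF eq, of "\<lambda>x. x $ k"] by (simp add: \<Psi>_def repl_nth)
  define D where "D = (\<lambda>t. z q' t - z q t)"
  have D': "(D has_real_derivative q' \<bullet> \<alpha> (pt q' t) - q \<bullet> \<alpha> (pt q t)) (at t within {0..1})"
    if t: "t \<in> {0..1}" for t
    unfolding D_def by (intro derivative_intros z_derivative q q' t)
  have pd: "norm (pt q' t - pt q t) = \<bar>D t\<bar>" for t
  proof -
    have "pt q' t - pt q t = D t *\<^sub>R e"
      using i by (simp add: vec_eq_iff pt_def repl_nth D_def axis_def)
    then show ?thesis by simp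
  qed
  have "\<bar>q' \<bullet> \<alpha> (pt q' t) - q \<bullet> \<alpha> (pt q t)\<bar> \<le> 1 / 4 * \<bar>D t\<bar> + 0" if t: "t \<in> {0..1}" for t
  proof -
    have "q' = repl k q (q' $ k)" using i by (simp add: vec_eq_iff repl_nth)
    then have "q' \<bullet> \<alpha> (pt q' t) = q \<bullet> \<alpha> (pt q' t)"
      using inner_repl[OF k_zero[OF pt_in_R[OF q' t]]] by metis
    then have "\<bar>q' \<bullet> \<alpha> (pt q' t) - q \<bullet> \<alpha> (pt q t)\<bar> = \<bar>q \<bullet> (\<alpha> (pt q' t) - \<alpha> (pt q t))\<bar>"
      by (simp add: inner_diff_right)
    also have "\<dots> \<le> norm q * (L * \<bar>D t\<bar>)"
      using order_trans[OF Cauchy_Schwarz_ineq2 mult_left_mono[OF lip[OF pt_in_C[OF q' t] pt_in_C[OF q t]]], of q]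
      by (simp add: pd)
    also have "\<dots> \<le> 1 / 4 * \<bar>D t\<bar>"
      using mult_right_mono[OF small[OF q], of "\<bar>D t\<bar>"] by (simp add: mult_ac)
    finally show ?thesis by simp
  qed
  from gronwall_small[OF D' this, of 1 0] have "\<bar>D 0\<bar> \<le> \<bar>D 1\<bar> / (1 - 1 / 4)" by simp
  moreover have "D 1 = 0" using Z by (simp add: D_def z_def)
  ultimately have "q $ k = q' $ k" by (simp add: D_def z_0 q q')
  then show "q = q'" using i by (metis vec_eq_iff)
qed

text \<open>Invariance of domain supplies the open image and a continuous inverse. Since
  \<open>W\<close> is an exponential, the derivative of \<open>\<Psi>\<close> inverts explicitly,
  and component \<open>k\<close> of the inverse is \<open>h $ k - \<alpha> y \<bullet> h\<close>
  divided by \<open>W\<close>; its kernel is the distribution.\<close>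

lemma \<Psi>_chart:
  obtains \<Phi> where "open (\<Psi> ` B)" "homeomorphism (\<Psi> ` B) B \<Phi> \<Psi>" "smooth_on (\<Psi> ` B) \<Phi>" "smooth_on B \<Psi>"
    "\<And>y h. y \<in> \<Psi> ` B \<Longrightarrow> frechet_derivative \<Phi> (at y) h $ k = 0 \<longleftrightarrow> h $ k = \<alpha> y \<bullet> h"
proof -
  have cont: "continuous_on B \<Psi>" using Ck_on_\<Psi> Ck_on_imp_continuous_on by blast
  obtain \<Phi> where hom: "homeomorphism B (\<Psi> ` B) \<Psi> \<Phi>"
    using invariance_of_domain_homeomorphism[OF open_B cont _ inj_on_\<Psi>] by auto
  have opV: "open (\<Psi> ` B)"
    using invariance_of_domain[OF cont open_B inj_on_\<Psi>] .
  have c\<Phi>: "continuous_on (\<Psi> ` B) \<Phi>" and \<Phi>\<Psi>: "\<And>q. q \<in> B \<Longrightarrow> \<Phi> (\<Psi> q) = q"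
    using hom by (auto simp: homeomorphism_def)
  have D\<Psi>: "(\<Psi> has_derivative (\<lambda>h. repl k h (\<alpha> (\<Psi> q) \<bullet> h + W q * h $ k))) (at q)" if "q \<in> B" for q
    unfolding \<Psi>_def repl_def[abs_def]
    by (rule has_derivative_eq_rhs, (rule derivative_intros Z_derivative[OF that]
          bounded_linear.has_derivative[OF bounded_linear_vec_nth])+)
      (simp add: fun_eq_iff repl_def)
  have D\<Phi>: "(\<Phi> has_derivative (\<lambda>h. repl k h ((h $ k + (- 1) * (\<alpha> y \<bullet> h)) * inverse (W (\<Phi> y))))) (at y)"
    if y: "y \<in> \<Psi> ` B" for y
  proof -
    obtain q where q: "q \<in> B" "y = \<Psi> q" using y by blast
    show ?thesis
    proof (rule has_derivative_inverse_basic[where f = \<Psi>, OF _ _ _ _ opV y])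
      show "(\<Psi> has_derivative (\<lambda>h. repl k h (\<alpha> y \<bullet> h + W q * h $ k))) (at (\<Phi> y))"
        using D\<Psi>[OF q(1)] q \<Phi>\<Psi> by simp
      show "bounded_linear (\<lambda>h. repl k h ((h $ k + (- 1) * (\<alpha> y \<bullet> h)) * inverse (W (\<Phi> y))))"
        unfolding repl_def
        by (intro bounded_linear_add bounded_linear_ident bounded_linear_sub bounded_linear_mult_const
            bounded_linear_const_mult bounded_linear_inner_right bounded_linear_vec_nth
            bounded_linear_compose[OF bounded_linear_scaleR_left])
      have \<alpha>_repl: "\<alpha> y \<bullet> repl k h c = \<alpha> y \<bullet> h" for h c
        using inner_repl[OF k_zero[OF \<Psi>_in_R[OF q(1)]]] q by (simp add: inner_commute)
      have W: "W q \<noteq> 0" "\<Phi> y = q" using q \<Phi>\<Psi> by (auto simp: W_def)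
      show "(\<lambda>h. repl k h ((h $ k + (- 1) * (\<alpha> y \<bullet> h)) * inverse (W (\<Phi> y)))) \<circ>
          (\<lambda>h. repl k h (\<alpha> y \<bullet> h + W q * h $ k)) = id"
        unfolding fun_eq_iff vec_eq_iff by (simp add: repl_nth \<alpha>_repl W)
      show "continuous (at y) \<Phi>"
        using c\<Phi> opV y continuous_on_eq_continuous_at by blast
      show "\<Psi> (\<Phi> y) = y" if "y \<in> \<Psi> ` B" for y
        using that \<Phi>\<Psi> by auto
    qed
  qed
  \<comment> \<open>Bootstrap: the derivative formula contains \<open>\<Phi>\<close> only inside
    \<open>W\<close>, which is already known to be smooth.\<close>
  have "Ck_on m (\<Psi> ` B) \<Phi>" for m
  proof (induction m)
    case (Suc m)
    have "Ck_on m (\<Psi> ` B) (\<lambda>y. W (\<Phi> y))"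
      by (rule Ck_on_compose[OF opV _ Ck_on_W[OF Ck_on_Z] Suc]) (use \<Phi>\<Psi> in auto)
    then have "Ck_on m (\<Psi> ` B) (\<lambda>y. inverse (W (\<Phi> y)))"
      by (intro Ck_on_compose[OF opV _ Ck_on_inverse]) (auto simp: W_def)
    moreover have "Ck_on m (\<Psi> ` B) \<alpha>"
      using smooth \<Psi>_in_R Ck_on_subset unfolding smooth_on_def by (metis image_subsetI)
    ultimately show ?case
      by (intro Ck_on_SucI[OF opV D\<Phi>] Ck_on_repl Ck_on_mult Ck_on_add Ck_on_inner Ck_on_const opV)
  qed (use c\<Phi> in simp)
  moreover have "frechet_derivative \<Phi> (at y) h $ k = 0 \<longleftrightarrow> h $ k = \<alpha> y \<bullet> h" if "y \<in> \<Psi> ` B" for y h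
    unfolding frechet_derivative_at[OF D\<Phi>[OF that], symmetric] by (simp add: repl_nth W_def)
  ultimately show ?thesis
    using that[OF opV homeomorphism_symD[OF hom]] Ck_on_\<Psi> by (simp add: smooth_on_def)
qed

end

text \<open>It remains to choose the sets of the locale: a compact box \<open>C\<close> of
  half-width \<open>r\<close> inside \<open>R\<close>, and a parameter box of half-width
  \<open>\<epsilon>\<close> so small that the solutions exist and stay in \<open>C\<close>.\<close>

lemma integrable_graph_distribution_chart_0:
  fixes \<alpha> :: "real ^ 'n \<Rightarrow> real ^ 'n"
  assumes open_R: "open R" and R0: "0 \<in> R" and smooth: "smooth_on R \<alpha>"
    and k_zero: "\<And>x. x \<in> R \<Longrightarrow> \<alpha> x $ k = 0"
    and integrability: "\<And>x i j. x \<in> R \<Longrightarrow> i $ k = 0 \<Longrightarrow> j $ k = 0 \<Longrightarrow>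
      frechet_derivative \<alpha> (at x) (i + (\<alpha> x \<bullet> i) *\<^sub>R axis k 1) \<bullet> j =
      frechet_derivative \<alpha> (at x) (j + (\<alpha> x \<bullet> j) *\<^sub>R axis k 1) \<bullet> i"
  obtains a b :: "real ^ 'n" and V \<Phi> \<Psi> where "open V" "0 \<in> V" "V \<subseteq> R" "homeomorphism V (box a b) \<Phi> \<Psi>"
    "smooth_on V \<Phi>" "smooth_on (box a b) \<Psi>"
    "\<And>y h. y \<in> V \<Longrightarrow> frechet_derivative \<Phi> (at y) h $ k = 0 \<longleftrightarrow> h $ k = \<alpha> y \<bullet> h"
proof -
  define n where "n = real CARD('n)"
  have n: "n \<ge> 1" by (simp add: n_def Suc_leI)
  have norm_le: "norm x \<le> n * s" if "\<And>i. \<bar>x $ i\<bar> \<le> s" for x :: "real ^ 'n" and s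
    using order_trans[OF norm_le_l1_cart sum_mono[of UNIV "\<lambda>i. \<bar>x $ i\<bar>" "\<lambda>i. s"]] that
    by (simp add: n_def)
  have mem_cbox: "x \<in> cbox (- vec s) (vec s) \<longleftrightarrow> (\<forall>i. \<bar>x $ i\<bar> \<le> s)" for x :: "real ^ 'n" and s
    by (auto simp: mem_box_cart abs_le_iff minus_le_iff)
  obtain d where d: "d > 0" "cball 0 d \<subseteq> R"
    using open_R R0 open_contains_cball by blast
  \<comment> \<open>The Euclidean norm is at most \<open>n\<close> times the largest component, so
    this box fits into the ball of radius \<open>d\<close>.\<close>
  define r where "r = d / n"
  define C where "C = (cbox (- vec r) (vec r) :: (real ^ 'n) set)"
  have r: "r > 0" using d n by (simp add: r_def)
  have CR: "C \<subseteq> R"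
  proof
    fix x assume "x \<in> C"
    then have "norm x \<le> n * r" by (intro norm_le) (simp add: C_def mem_cbox)
    then show "x \<in> R" using d n by (auto simp: r_def)
  qed
  have C: "compact C" "convex C" by (auto simp: C_def)
  have Ck: "Ck_on m R \<alpha>" for m using smooth by (simp add: smooth_on_def)
  have c\<alpha>: "continuous_on C \<alpha>" using Ck_on_imp_continuous_on[OF Ck] CR continuous_on_subset by blast
  obtain M where M: "\<And>x. x \<in> C \<Longrightarrow> norm (\<alpha> x) \<le> M"
    using compact_imp_bounded[OF compact_continuous_image[OF c\<alpha> C(1)]] by (auto simp: bounded_iff)
  have C0: "0 \<in> C" using r by (simp add: C_def mem_cbox)
  then have M0: "0 \<le> M" using M norm_ge_zero order_trans by blast
  obtain L where L: "0 \<le> L" "\<And>x v. x \<in> C \<Longrightarrow> norm (frechet_derivative \<alpha> (at x) v) \<le> L * norm v"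
    "\<And>x y. x \<in> C \<Longrightarrow> y \<in> C \<Longrightarrow> norm (\<alpha> x - \<alpha> y) \<le> L * norm (x - y)"
    using C1_bounds[OF Ck C CR] by blast
  obtain K where K: "0 \<le> K" "\<And>x y. x \<in> C \<Longrightarrow> y \<in> C \<Longrightarrow>
    norm (\<alpha> y - \<alpha> x - frechet_derivative \<alpha> (at x) (y - x)) \<le> K * (norm (y - x))\<^sup>2"
    using C2_taylor_bound[OF Ck C CR] by blast
  \<comment> \<open>After multiplying out, three nonnegative terms add up to \<open>r\<close>. The
    first two give \<open>\<epsilon> + n * \<epsilon> * M \<le> r\<close>, which confines the
    solution to \<open>C\<close>; the third gives the contraction condition
    \<open>n * \<epsilon> * L \<le> 1 / 4\<close>.\<close>
  define \<epsilon> where "\<epsilon> = r / (1 + n * M + 4 * n * L * r)"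
  have den: "1 + n * M + 4 * n * L * r \<ge> 1" using n M0 L(1) r by simp
  have \<epsilon>: "\<epsilon> > 0" using r den by (simp add: \<epsilon>_def)
  have \<epsilon>_eq: "\<epsilon> + \<epsilon> * (n * M) + \<epsilon> * (4 * n * L * r) = r"
  proof -
    have "\<epsilon> * (1 + n * M + 4 * n * L * r) = r" using den by (simp add: \<epsilon>_def)
    then show ?thesis by (simp only: distrib_left mult_1_right)
  qed
  have "0 \<le> \<epsilon> * (n * M)" "0 \<le> \<epsilon> * (4 * n * L * r)"
    using \<epsilon> n M0 L(1) r by simp_all
  then have "\<epsilon> + \<epsilon> * (n * M) \<le> r" "\<epsilon> \<le> r" "\<epsilon> * (4 * n * L * r) \<le> r"
    using \<epsilon>_eq \<epsilon> by linarith+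
  then have \<epsilon>r: "\<epsilon> + n * \<epsilon> * M \<le> r" "\<epsilon> \<le> r" and "(n * \<epsilon> * L * 4) * r \<le> r"
    by (simp_all only: mult_ac)
  then have \<epsilon>L: "n * \<epsilon> * L \<le> 1 / 4" using mult_right_le_imp_le[of "n * \<epsilon> * L * 4" r 1] r by simp
  \<comment> \<open>Composing \<open>\<alpha>\<close> with the projection to \<open>C\<close>
    extends it to a bounded, globally Lipschitz map, as the fixed point lemma demands.\<close>
  define cl where "cl = (clamp (- vec r) (vec r) :: real ^ 'n \<Rightarrow> real ^ 'n)"
  have cl: "cl x \<in> C" for x
    unfolding cl_def C_def by (rule clamp_in_interval) (use r in \<open>auto simp: Basis_vec_def inner_axis\<close>)
  have cl_eq: "cl x = x" if "x \<in> C" for x using that by (simp add: cl_def C_def)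
  have cl_lip: "norm (cl x - cl y) \<le> norm (x - y)" for x y
    using dist_clamps_le_dist_args[of "- vec r" "vec r" x y] by (simp add: cl_def dist_norm)
  have nq: "norm q \<le> n * \<epsilon>" if "q \<in> cbox (- vec \<epsilon>) (vec \<epsilon>)" for q :: "real ^ 'n"
    using that by (intro norm_le) (simp add: mem_cbox)
  obtain Z where cZ: "continuous_on (cbox (- vec \<epsilon>) (vec \<epsilon>)) Z"
    and Z: "\<And>q. q \<in> cbox (- vec \<epsilon>) (vec \<epsilon>) \<Longrightarrow>
       Z q = q $ k + integral {0..1} (\<lambda>t. q \<bullet> \<alpha> (cl (repl k (t *\<^sub>R q) (Z (shrink k t q)))))"
  proof (rule ray_equation_solvable[of "\<lambda>x. \<alpha> (cl x)" L M "vec \<epsilon>" k])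
    show "norm (\<alpha> (cl x) - \<alpha> (cl y)) \<le> L * norm (x - y)" for x y
      by (rule order_trans[OF L(3)[OF cl cl]]) (intro mult_left_mono cl_lip L)
    show "norm q * L \<le> 1 / 4" if "q \<in> cbox (- vec \<epsilon>) (vec \<epsilon>)" for q :: "real ^ 'n"
      using mult_right_mono[OF nq[OF that] L(1)] \<epsilon>L by linarith
  qed (use L M cl \<epsilon> in auto)
  have Z_le: "\<bar>Z q\<bar> \<le> r" if q: "q \<in> cbox (- vec \<epsilon>) (vec \<epsilon>)" for q
  proof -
    let ?f = "\<lambda>t. q \<bullet> \<alpha> (cl (repl k (t *\<^sub>R q) (Z (shrink k t q))))"
    have c: "continuous_on {0..1} (\<lambda>t. repl k (t *\<^sub>R q) (Z (shrink k t q)))"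
      by (intro continuous_intros continuous_on_compose2[OF cZ]) (auto intro: shrink_in_cbox q)
    have "continuous_on UNIV cl"
      unfolding cl_def using clamp_continuous_on[OF continuous_on_id] by simp
    then have "continuous_on {0..1} (\<lambda>t. cl (repl k (t *\<^sub>R q) (Z (shrink k t q))))"
      by (rule continuous_on_compose2[OF _ c]) simp
    then have "continuous_on {0..1} ?f"
      by (intro continuous_on_inner continuous_on_const continuous_on_compose2[OF c\<alpha>]) (use cl in auto)
    moreover have "norm (?f t) \<le> n * \<epsilon> * M" for t
      unfolding real_norm_def
      by (rule order_trans[OF Cauchy_Schwarz_ineq2]) (intro mult_mono nq q M cl norm_ge_zero, use n \<epsilon> in simp)
    ultimately have "norm (integral {0..1} ?f) \<le> n * \<epsilon> * M"
      using integral_bound[of 0 1 ?f "n * \<epsilon> * M"] by simp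
    moreover have "\<bar>q $ k\<bar> \<le> \<epsilon>" using q by (simp add: mem_cbox)
    ultimately show ?thesis using \<epsilon>r(1) unfolding Z[OF q] by simp
  qed
  have inC: "repl k (t *\<^sub>R q) (Z (shrink k t q)) \<in> C" if q: "q \<in> cbox (- vec \<epsilon>) (vec \<epsilon>)" and t: "t \<in> {0..1}" for q t
  proof -
    have "\<bar>t * q $ i\<bar> \<le> r" for i
    proof -
      have "\<bar>q $ i\<bar> \<le> \<epsilon>" using q by (simp add: mem_cbox)
      then have "\<bar>t\<bar> * \<bar>q $ i\<bar> \<le> 1 * \<epsilon>" using t by (intro mult_mono) auto
      then show ?thesis using \<epsilon>r by (simp add: abs_mult)
    qed
    then show ?thesis
      using Z_le[OF shrink_in_cbox[OF q t]] by (simp add: C_def mem_cbox repl_nth)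
  qed
  let ?B = "box (- vec \<epsilon>) (vec \<epsilon>) :: (real ^ 'n) set"
  have sub: "q \<in> cbox (- vec \<epsilon>) (vec \<epsilon>)" if "q \<in> ?B" for q using that box_subset_cbox by blast
  interpret ray_solution k \<alpha> R C ?B Z L K M
  proof
    \<comment> \<open>The clamp disappears because the solution curves lie in
      \<open>C\<close>.\<close>
    show "Z q = q $ k + integral {0..1} (\<lambda>t. q \<bullet> \<alpha> (repl k (t *\<^sub>R q) (Z (shrink k t q))))" if "q \<in> ?B" for q
      unfolding Z[OF sub[OF that]]
      by (intro arg_cong2[where f = "(+)"] refl integral_cong) (simp add: cl_eq inC sub that)
    show "norm q * L \<le> 1 / 4" if "q \<in> ?B" for q
      using mult_right_mono[OF nq[OF sub[OF that]] L(1)] \<epsilon>L by linarith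
    show "continuous_on ?B Z" using cZ continuous_on_subset box_subset_cbox by blast
  qed (fact open_R smooth k_zero integrability CR M M0 L K open_box shrink_in_box inC[OF sub])+
  obtain \<Phi> where \<Phi>: "open (\<Psi> ` ?B)" "homeomorphism (\<Psi> ` ?B) ?B \<Phi> \<Psi>" "smooth_on (\<Psi> ` ?B) \<Phi>"
    "smooth_on ?B \<Psi>"
    "\<And>y h. y \<in> \<Psi> ` ?B \<Longrightarrow> frechet_derivative \<Phi> (at y) h $ k = 0 \<longleftrightarrow> h $ k = \<alpha> y \<bullet> h"
    using \<Psi>_chart by blast
  have B0: "0 \<in> ?B" using \<epsilon> by (simp add: mem_box_cart)
  \<comment> \<open>At \<open>q = 0\<close> the integrand vanishes, so the chart is indeed around
    the origin.\<close>
  have "\<Psi> 0 = 0" using Z[OF sub[OF B0]] by (simp add: \<Psi>_def vec_eq_iff repl_nth)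
  then have "0 \<in> \<Psi> ` ?B" using B0 by (metis imageI)
  then show ?thesis using that[of "\<Psi> ` ?B", OF \<Phi>(1) _ _ \<Phi>(2-5)] \<Psi>_in_R by blast
qed

lemma frechet_derivative_shift:
  assumes "f differentiable (at (x + c))"
  shows "((\<lambda>x. f (x + c)) has_derivative frechet_derivative f (at (x + c))) (at x)"
proof -
  have "((\<lambda>x. x + c) has_derivative (\<lambda>v. v)) (at x)"
    by (rule derivative_eq_intros refl | simp)+
  from has_derivative_compose[OF this] show ?thesis
    using assms frechet_derivative_works by blast
qed

text \<open>A translation moves \<open>x0\<close> to the origin and leaves derivatives
  unchanged.\<close>

lemma integrable_graph_distribution_chart:
  fixes \<alpha> :: "real ^ 'n \<Rightarrow> real ^ 'n"
  assumes open_R: "open R" and x0: "x0 \<in> R" and smooth: "smooth_on R \<alpha>"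
    and k_zero: "\<And>x. x \<in> R \<Longrightarrow> \<alpha> x $ k = 0"
    and integrability: "\<And>x i j. x \<in> R \<Longrightarrow> i $ k = 0 \<Longrightarrow> j $ k = 0 \<Longrightarrow>
      frechet_derivative \<alpha> (at x) (i + (\<alpha> x \<bullet> i) *\<^sub>R axis k 1) \<bullet> j =
      frechet_derivative \<alpha> (at x) (j + (\<alpha> x \<bullet> j) *\<^sub>R axis k 1) \<bullet> i"
  obtains a b :: "real ^ 'n" and V \<Phi> \<Psi> where "open V" "x0 \<in> V" "V \<subseteq> R" "homeomorphism V (box a b) \<Phi> \<Psi>"
    "smooth_on V \<Phi>" "smooth_on (box a b) \<Psi>"
    "\<And>y h. y \<in> V \<Longrightarrow> frechet_derivative \<Phi> (at y) h $ k = 0 \<longleftrightarrow> h $ k = \<alpha> y \<bullet> h"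
proof -
  let ?\<alpha> = "\<lambda>x. \<alpha> (x + x0)" and ?R = "(\<lambda>x. x + - x0) ` R"
  have op: "open ?R" using open_translation[OF open_R, of "- x0"] by (simp add: add.commute)
  have shift: "smooth_on S (\<lambda>x :: real ^ 'n. x + c)" if "open S" for S c
    by (intro smooth_on_add smooth_on_id smooth_on_const that)
  have der: "frechet_derivative ?\<alpha> (at x) = frechet_derivative \<alpha> (at (x + x0))" if "x + x0 \<in> R" for x
    using frechet_derivative_shift[of \<alpha> x x0] smooth_on_derivative[OF smooth that]
      differentiableI frechet_derivative_at by metis
  have R0: "0 \<in> ?R" using x0 by force
  have sm: "smooth_on ?R ?\<alpha>"
    by (rule smooth_on_compose[OF op _ smooth shift[OF op]]) auto
  have kz: "?\<alpha> x $ k = 0" if "x \<in> ?R" for x using that k_zero by auto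
  have int: "frechet_derivative ?\<alpha> (at x) (i + (?\<alpha> x \<bullet> i) *\<^sub>R axis k 1) \<bullet> j =
      frechet_derivative ?\<alpha> (at x) (j + (?\<alpha> x \<bullet> j) *\<^sub>R axis k 1) \<bullet> i"
    if "x \<in> ?R" "i $ k = 0" "j $ k = 0" for x i j
    using that integrability[of "x + x0" i j] der[of x] by auto
  obtain a b :: "real ^ 'n" and V \<Phi> \<Psi> where *: "open V" "0 \<in> V" "V \<subseteq> ?R" "homeomorphism V (box a b) \<Phi> \<Psi>"
    "smooth_on V \<Phi>" "smooth_on (box a b) \<Psi>"
    and ker: "\<And>y h. y \<in> V \<Longrightarrow> frechet_derivative \<Phi> (at y) h $ k = 0 \<longleftrightarrow> h $ k = ?\<alpha> y \<bullet> h"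
    by (rule integrable_graph_distribution_chart_0[OF op R0 sm kz int]) (assumption | rule that)+
  let ?V = "(\<lambda>x. x + x0) ` V" and ?\<Phi> = "\<lambda>x. \<Phi> (x + - x0)" and ?\<Psi> = "\<lambda>x. \<Psi> x + x0"
  show ?thesis
  proof (rule that[of ?V a b ?\<Phi> ?\<Psi>])
    show opV: "open ?V" using open_translation[OF *(1), of "x0"] by (simp add: add.commute)
    show "x0 \<in> ?V" using *(2) by force
    show "?V \<subseteq> R" using *(3) by auto
    show "homeomorphism ?V (box a b) ?\<Phi> ?\<Psi>"
      using *(4) unfolding homeomorphism_def
      by (auto simp: image_image intro!: continuous_intros continuous_on_compose2[of V \<Phi>]) 
    show "smooth_on ?V ?\<Phi>"
      by (rule smooth_on_compose[OF opV _ *(5) shift[OF opV]]) auto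
    show "smooth_on (box a b) ?\<Psi>"
      by (intro smooth_on_add *(6) smooth_on_const open_box)
    fix y h assume y: "y \<in> ?V"
    then have yV: "y + - x0 \<in> V" by auto
    have "frechet_derivative ?\<Phi> (at y) = frechet_derivative \<Phi> (at (y + - x0))"
      using frechet_derivative_shift[of \<Phi> y "- x0"] smooth_on_derivative[OF *(5) yV]
        differentiableI frechet_derivative_at by metis
    then show "frechet_derivative ?\<Phi> (at y) h $ k = 0 \<longleftrightarrow> h $ k = \<alpha> y \<bullet> h"
      using ker[OF yV, of h] by simp
  qed
qed

text \<open>Rescaling the form by \<open>inverse (w x $ k)\<close> preserves its kernel, and it
  preserves the symmetry of the derivative on that kernel because the derivative of the scale factor
  is multiplied by \<open>w\<close> itself.\<close>

lemma frobenius_chart: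
  fixes w :: "real ^ 'n \<Rightarrow> real ^ 'n"
  assumes open_S: "open S" and x0: "x0 \<in> S" "w x0 \<noteq> 0" and smooth: "smooth_on S w"
    and closed: "\<And>x X Y. x \<in> S \<Longrightarrow> w x \<bullet> X = 0 \<Longrightarrow> w x \<bullet> Y = 0 \<Longrightarrow>
      frechet_derivative w (at x) X \<bullet> Y = frechet_derivative w (at x) Y \<bullet> X"
  obtains a b :: "real ^ 'n" and V k \<Phi> \<Psi> where "open V" "x0 \<in> V" "V \<subseteq> S" "homeomorphism V (box a b) \<Phi> \<Psi>"
    "smooth_on V \<Phi>" "smooth_on (box a b) \<Psi>"
    "\<And>y h. y \<in> V \<Longrightarrow> frechet_derivative \<Phi> (at y) h $ k = 0 \<longleftrightarrow> w y \<bullet> h = 0"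
proof -
  obtain k where k: "w x0 $ k \<noteq> 0" using x0(2) by (auto simp: vec_eq_iff)
  define R where "R = S \<inter> (\<lambda>x. w x $ k) -` (- {0})"
  have R: "R \<subseteq> S" "\<And>x. x \<in> R \<Longrightarrow> w x $ k \<noteq> 0" "x0 \<in> R" using k x0 by (auto simp: R_def)
  have wk: "smooth_on S (\<lambda>x. w x $ k)" using smooth_on_vec_nth[OF open_S smooth] .
  have open_R: "open R"
    unfolding R_def
    by (intro continuous_open_preimage smooth_on_imp_continuous_on[OF wk] open_S) auto
  define s where "s = (\<lambda>x. inverse (w x $ k))"
  have s: "smooth_on R s"
    unfolding s_def by (intro smooth_on_inverse open_R smooth_on_subset[OF wk] R)
  \<comment> \<open>Chosen so that \<open>h $ k - \<alpha> x \<bullet> h\<close> is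
    \<open>w x \<bullet> h\<close> divided by \<open>w x $ k\<close>: both forms have the same
    kernel, and component \<open>k\<close> of \<open>\<alpha>\<close> vanishes.\<close>
  define \<alpha> where "\<alpha> = (\<lambda>x. axis k 1 + ((- 1) * s x) *\<^sub>R w x)"
  have \<alpha>: "smooth_on R \<alpha>"
    unfolding \<alpha>_def
    by (intro smooth_on_add smooth_on_scaleR smooth_on_mult smooth_on_const open_R s smooth_on_subset[OF smooth] R)
  have \<alpha>k: "\<alpha> x $ k = 0" if "x \<in> R" for x
    using R(2)[OF that] by (simp add: \<alpha>_def s_def)
  have \<alpha>_inner: "\<alpha> x \<bullet> h = h $ k - s x * (w x \<bullet> h)" for x h
    by (simp add: \<alpha>_def inner_diff_left inner_axis')
  have ker: "w x \<bullet> (i + (\<alpha> x \<bullet> i) *\<^sub>R axis k 1) = 0" if "x \<in> R" "i $ k = 0" for x i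
    using R(2)[OF that(1)] that(2) by (simp add: \<alpha>_inner inner_add_right inner_diff_right inner_axis s_def)
  let ?w' = "\<lambda>x. frechet_derivative w (at x)" and ?s' = "\<lambda>x. frechet_derivative s (at x)"
  have \<alpha>': "frechet_derivative \<alpha> (at x) v = - (?s' x v *\<^sub>R w x) - s x *\<^sub>R ?w' x v" if x: "x \<in> R" for x v
  proof -
    have "(\<alpha> has_derivative (\<lambda>v. - (?s' x v *\<^sub>R w x) - s x *\<^sub>R ?w' x v)) (at x)"
      unfolding \<alpha>_def
      by (rule has_derivative_eq_rhs,
          (rule derivative_intros smooth_on_derivative[OF s x] smooth_on_derivative[OF smooth] subsetD[OF R(1)] x)+)
        (simp add: fun_eq_iff)
    from fun_cong[OF frechet_derivative_at[OF this], of v] show ?thesis by (rule sym)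
  qed
  have int: "frechet_derivative \<alpha> (at x) (i + (\<alpha> x \<bullet> i) *\<^sub>R axis k 1) \<bullet> j =
      frechet_derivative \<alpha> (at x) (j + (\<alpha> x \<bullet> j) *\<^sub>R axis k 1) \<bullet> i"
    if x: "x \<in> R" and ij: "i $ k = 0" "j $ k = 0" for x i j
  proof -
    define X where "X = (\<lambda>i. i + (\<alpha> x \<bullet> i) *\<^sub>R axis k 1)"
    have X: "w x \<bullet> X i = 0" if "i $ k = 0" for i
      unfolding X_def using ker[OF x that] .
    have "frechet_derivative \<alpha> (at x) v $ k = 0" for v
      using derivative_nth_eq_0[OF smooth_on_derivative[OF \<alpha> x] open_R x \<alpha>k] .
    \<comment> \<open>The derivative of \<open>\<alpha>\<close> has no component \<open>k\<close>,
      so \<open>j\<close> may be replaced by its lift \<open>X j\<close>, which is annihilated by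
      \<open>w x\<close>.\<close>
    then have eq: "frechet_derivative \<alpha> (at x) v \<bullet> j = frechet_derivative \<alpha> (at x) v \<bullet> X j" for v j
      by (simp add: X_def inner_add_right inner_axis)
    have "frechet_derivative \<alpha> (at x) (X i) \<bullet> j = - (s x * (?w' x (X i) \<bullet> X j))" if "j $ k = 0" for i j
      by (subst eq) (simp add: \<alpha>'[OF x] inner_diff_left X[OF that])
    then show ?thesis
      using closed[OF subsetD[OF R(1) x] X[OF ij(1)] X[OF ij(2)]] ij by (simp add: X_def)
  qed
  obtain a b :: "real ^ 'n" and V \<Phi> \<Psi> where *: "open V" "x0 \<in> V" "V \<subseteq> R" "homeomorphism V (box a b) \<Phi> \<Psi>"
    "smooth_on V \<Phi>" "smooth_on (box a b) \<Psi>"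
    and V: "\<And>y h. y \<in> V \<Longrightarrow> frechet_derivative \<Phi> (at y) h $ k = 0 \<longleftrightarrow> h $ k = \<alpha> y \<bullet> h"
    by (rule integrable_graph_distribution_chart[OF open_R R(3) \<alpha> \<alpha>k int]) (assumption | rule that)+
  show ?thesis
  proof (rule that[of V a b \<Phi> \<Psi> k])
    show "V \<subseteq> S" using *(3) R(1) by blast
    show "frechet_derivative \<Phi> (at y) h $ k = 0 \<longleftrightarrow> w y \<bullet> h = 0" if "y \<in> V" for y h
      using V[OF that, of h] R(2)[of y] that *(3) by (auto simp: \<alpha>_inner s_def)
  qed (fact *)+
qed

section \<open>Foliations of manifolds\<close>

lemma chart_homeomorphism:
  "is_chart c \<Longrightarrow> homeomorphism (cdom c) (cmap c ` cdom c) (cmap c) (cinv c)"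
  by (simp add: is_chart_def)

lemma cinv_cmap: "is_chart c \<Longrightarrow> p \<in> cdom c \<Longrightarrow> cinv c (cmap c p) = p"
  using chart_homeomorphism homeomorphism_apply1 by blast

lemma open_cmap_image:
  assumes "is_chart c" "open W" shows "open (cmap c ` (cdom c \<inter> W))"
proof -
  have "openin (top_of_set (cdom c)) (cdom c \<inter> W)" using assms(2) by auto
  then have "openin (top_of_set (cmap c ` cdom c)) (cmap c ` (cdom c \<inter> W))"
    using homeomorphism_imp_open_map[OF chart_homeomorphism[OF assms(1)]] by blast
  then show ?thesis using assms(1) openin_open_trans unfolding is_chart_def by blast
qed

lemma open_cinv_image:
  assumes "is_chart c" "open V" "V \<subseteq> cmap c ` cdom c" shows "open (cinv c ` V)"
proof -
  have "openin (top_of_set (cmap c ` cdom c)) V" using assms(2,3) open_subset by blast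
  then have "openin (top_of_set (cdom c)) (cinv c ` V)"
    using homeomorphism_imp_open_map[OF homeomorphism_symD[OF chart_homeomorphism[OF assms(1)]]] by blast
  then show ?thesis using assms(1) openin_open_trans unfolding is_chart_def by blast
qed

lemma cinv_image:
  assumes "is_chart c" "V \<subseteq> cmap c ` cdom c"
  shows "cinv c ` V = {p \<in> cdom c. cmap c p \<in> V}"
proof -
  have "V = cmap c ` {p \<in> cdom c. cmap c p \<in> V}" using assms(2) by blast
  then have "cinv c ` V = cinv c ` cmap c ` {p \<in> cdom c. cmap c p \<in> V}"
    by (rule arg_cong)
  also have "\<dots> = (\<lambda>p. cinv c (cmap c p)) ` {p \<in> cdom c. cmap c p \<in> V}"
    by (rule image_image)
  also have "\<dots> = (\<lambda>p. p) ` {p \<in> cdom c. cmap c p \<in> V}"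
    by (rule image_cong) (simp_all add: cinv_cmap[OF assms(1)])
  finally show ?thesis by simp
qed

lemma cmap_cinv_image:
  assumes "is_chart c" "V \<subseteq> cmap c ` cdom c"
  shows "cmap c ` cinv c ` V = V"
proof -
  have "cmap c (cinv c y) = y" if "y \<in> V" for y
    using homeomorphism_apply2[OF chart_homeomorphism[OF assms(1)]] assms(2) that by blast
  then show ?thesis by (simp add: image_image)
qed

lemma smooth_manifoldD:
  assumes "smooth_manifold A"
  shows "c \<in> A \<Longrightarrow> is_chart c"
    and "c \<in> A \<Longrightarrow> d \<in> A \<Longrightarrow> smooth_on (cmap c ` (cdom c \<inter> cdom d)) (transition c d)"
  using assms by (auto simp: smooth_manifold_def compatible_def)

lemma open_overlap:
  assumes "smooth_manifold A" "c \<in> A" "d \<in> A"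
  shows "open (cmap c ` (cdom c \<inter> cdom d))"
  using open_cmap_image smooth_manifoldD(1)[OF assms(1)] assms(2,3) is_chart_def by blast

lemma transition_derivative:
  assumes "smooth_manifold A" "c \<in> A" "d \<in> A" "p \<in> cdom c \<inter> cdom d"
  shows "(transition c d has_derivative jac c d p) (at (cmap c p))"
  unfolding jac_def
  by (rule smooth_on_derivative[OF smooth_manifoldD(2)[OF assms(1-3)]]) (use assms(4) in blast)

text \<open>The two transition maps compose to the identity on the open overlap; the chain rule does
  the rest.\<close>

lemma jac_inverse:
  assumes M: "smooth_manifold A" and cd: "c \<in> A" "d \<in> A" and p: "p \<in> cdom c \<inter> cdom d"
  shows "jac d c p (jac c d p v) = v"
proof -
  have c: "is_chart c" and d: "is_chart d" using smooth_manifoldD(1)[OF M] cd by auto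
  have "(transition d c has_derivative jac d c p) (at (transition c d (cmap c p)))"
    using transition_derivative[OF M cd(2,1)] p cinv_cmap[OF c, of p] by (simp add: transition_def)
  from diff_chain_at[OF transition_derivative[OF M cd p] this]
  have "((\<lambda>x. x) has_derivative jac d c p \<circ> jac c d p) (at (cmap c p))"
    by (rule has_derivative_transform_within_open[OF _ open_overlap[OF M cd]])
      (use p c d in \<open>auto simp: transition_def cinv_cmap\<close>)
  from has_derivative_unique[OF this has_derivative_ident] show ?thesis
    by (metis comp_apply)
qed

text \<open>Here the maximality of the atlas enters. The straightened chart is compatible with every
  chart \<open>d\<close>, since its transition maps are those of \<open>c\<close> composed with the
  smooth maps \<open>\<Phi>\<close> and \<open>\<Psi>\<close>.\<close>

lemma subchart_in_atlas:
  fixes A :: "('m::{t2_space, second_countable_topology}, 'n::finite) chart set" and a b :: "real ^ 'n"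
  assumes M: "smooth_manifold A" and c: "c \<in> A"
    and V: "open V" "V \<subseteq> cmap c ` cdom c" "homeomorphism V (box a b) \<Phi> \<Psi>"
    and \<Phi>: "smooth_on V \<Phi>" and \<Psi>: "smooth_on (box a b) \<Psi>"
  shows "(cinv c ` V, \<Phi> \<circ> cmap c) \<in> A"
proof -
  define c' where "c' = (cinv c ` V, \<Phi> \<circ> cmap c)"
  have cc: "is_chart c" using smooth_manifoldD(1)[OF M c] .
  have VV: "cmap c ` (cinv c ` V) = V" by (rule cmap_cinv_image[OF cc V(2)])
  have "homeomorphism (cinv c ` V) V (cmap c) (cinv c)"
    by (rule homeomorphism_of_subsets[OF chart_homeomorphism[OF cc]])
      (use VV cinv_image[OF cc V(2)] in auto)
  from homeomorphism_compose[OF this V(3)]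
  have hom: "homeomorphism (cdom c') (box a b) (cmap c') (cinv c \<circ> \<Psi>)" by (simp add: c'_def)
  have box: "cmap c' ` cdom c' = box a b" using hom homeomorphism_image1 by blast
  have inj: "inj_on (cmap c') (cdom c')"
    using homeomorphism_apply1[OF hom] by (metis inj_onI)
  \<comment> \<open>\<open>cinv\<close> is chosen by \<open>inv_into\<close>, so it agrees with the
    composed inverse on the box, but its values elsewhere are unspecified.\<close>
  have cinv': "cinv c' y = cinv c (\<Psi> y)" if "y \<in> box a b" for y
    unfolding cinv_def[of c']
    by (rule inv_into_f_eq[OF inj]) (use homeomorphism_image2[OF hom] homeomorphism_apply2[OF hom] that in auto)
  have c': "is_chart c'"
    unfolding is_chart_def
  proof (intro conjI)
    show "open (cdom c')" using open_cinv_image[OF cc V(1,2)] by (simp add: c'_def)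
    show "open (cmap c' ` cdom c')" by (simp add: box open_box)
    show "homeomorphism (cdom c') (cmap c' ` cdom c') (cmap c') (cinv c')"
      unfolding box by (rule homeomorphism_cong[OF hom]) (use cinv' in auto)
  qed
  have dom: "cdom c' \<subseteq> cdom c" using cinv_image[OF cc V(2)] by (auto simp: c'_def)
  have dom_V: "p \<in> cdom c' \<Longrightarrow> cmap c p \<in> V" for p using cinv_image[OF cc V(2)] by (auto simp: c'_def)
  have "compatible c' d" if d: "d \<in> A" for d
    unfolding compatible_def
  proof (intro conjI)
    have dd: "is_chart d" using smooth_manifoldD(1)[OF M d] .
    have op: "open (cmap c' ` (cdom c' \<inter> cdom d))" "open (cmap d ` (cdom c' \<inter> cdom d))"
      using open_cmap_image[OF c', of "cdom d"] open_cmap_image[OF dd, of "cdom c'"] c' dd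
      by (auto simp: is_chart_def Int_commute)
    let ?O = "cmap c' ` (cdom c' \<inter> cdom d)"
    have sub: "?O \<subseteq> box a b" using box by blast
    have \<Psi>O: "\<Psi> ` ?O \<subseteq> cmap c ` (cdom c \<inter> cdom d)"
      using dom dom_V homeomorphism_apply1[OF V(3)] by (force simp: c'_def)
    have "smooth_on ?O (\<lambda>x. transition c d (\<Psi> x))"
      by (rule smooth_on_compose[OF op(1) \<Psi>O smooth_manifoldD(2)[OF M c d] smooth_on_subset[OF \<Psi> sub]])
    then show "smooth_on ?O (transition c' d)"
      by (rule smooth_on_cong[OF _ op(1) order_refl]) (use cinv' sub in \<open>auto simp: transition_def\<close>)
    have "smooth_on (cmap d ` (cdom c' \<inter> cdom d)) (\<lambda>x. \<Phi> (transition d c x))"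
    proof (rule smooth_on_compose[OF op(2) _ \<Phi>])
      show "transition d c ` cmap d ` (cdom c' \<inter> cdom d) \<subseteq> V"
        using dom_V by (auto simp: transition_def cinv_cmap[OF dd])
      show "smooth_on (cmap d ` (cdom c' \<inter> cdom d)) (transition d c)"
        by (rule smooth_on_subset[OF smooth_manifoldD(2)[OF M d c]]) (use dom in auto)
    qed
    then show "smooth_on (cmap d ` (cdom c' \<inter> cdom d)) (transition d c')"
      by (simp add: transition_def c'_def comp_assoc comp_def)
  qed
  with M c' show ?thesis unfolding smooth_manifold_def c'_def by blast
qed

section \<open>The metric and lowered fields in charts\<close>

lemma symmetric_nth:
  fixes M :: "'a ^ 'n ^ 'n"
  assumes "transpose M = M" shows "M $ i $ j = M $ j $ i"
proof -
  have "M $ i $ j = transpose M $ i $ j" by (simp only: assms)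
  then show ?thesis by (simp only: transpose_def vec_lambda_beta)
qed

text \<open>\<open>low\<close> contracts the second index of the metric, whereas
  \<open>gprod\<close> takes \<open>X\<close> in the first slot; symmetry reconciles the
  two.\<close>

lemma inner_low:
  assumes "transpose (g c p) = g c p"
  shows "low g X c p \<bullet> v = gprod g c p (X c p) v"
proof -
  have "g c p $ i $ j = g c p $ j $ i" for i j using symmetric_nth[OF assms] .
  then show ?thesis
    unfolding inner_vec_def low_def gprod_def
    by (simp add: sum_distrib_right sum_distrib_left mult_ac) (subst sum.swap, simp)
qed

text \<open>Only the derivative in the direction of the segment enters. This serves to compare
  plaques: in a convex coordinate ball, two points on one plaque are joined by a segment inside
  it.\<close>

lemma constant_along_segment:
  fixes f :: "'a::real_normed_vector \<Rightarrow> real"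
  assumes der: "\<And>z. z \<in> closed_segment x y \<Longrightarrow> (f has_derivative f' z) (at z)"
    and vanish: "\<And>z. z \<in> closed_segment x y \<Longrightarrow> f' z (y - x) = 0"
  shows "f y = f x"
proof -
  let ?\<gamma> = "\<lambda>t. x + t *\<^sub>R (y - x)"
  have "((\<lambda>t. f (?\<gamma> t)) has_derivative (\<lambda>h. 0)) (at t within {0..1})" if t: "t \<in> {0..1}" for t
  proof -
    have seg: "?\<gamma> t \<in> closed_segment x y"
      using t by (auto simp: in_segment algebra_simps intro!: exI[of _ t])
    interpret linear "f' (?\<gamma> t)" using der[OF seg] has_derivative_linear by blast
    have "(?\<gamma> has_derivative (\<lambda>h. h *\<^sub>R (y - x))) (at t within {0..1})"
      by (rule derivative_eq_intros refl | simp)+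
    from has_derivative_compose[OF this der[OF seg]]
    show ?thesis by (simp add: scale vanish[OF seg])
  qed
  then have "f (?\<gamma> 1) = f (?\<gamma> 0)"
    by (intro has_derivative_zero_unique[of "{0..1::real}" "\<lambda>t. f (?\<gamma> t)"]) auto
  then show ?thesis by simp
qed

lemma lorentzian_metricD:
  assumes "lorentzian_metric A g"
  shows "c \<in> A \<Longrightarrow> smooth_on (cmap c ` cdom c) (g c \<circ> cinv c)"
    and "c \<in> A \<Longrightarrow> d \<in> A \<Longrightarrow> p \<in> cdom c \<inter> cdom d \<Longrightarrow>
      gprod g c p v w = gprod g d p (jac c d p v) (jac c d p w)"
    and "c \<in> A \<Longrightarrow> p \<in> cdom c \<Longrightarrow> transpose (g c p) = g c p"
  using assms unfolding lorentzian_metric_def by blast+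

lemma gprod_jac:
  assumes "lorentzian_metric A g" "smooth_vfield A U X" "c \<in> A" "d \<in> A" "p \<in> cdom c \<inter> cdom d \<inter> U"
  shows "gprod g d p (X d p) (jac c d p v) = gprod g c p (X c p) v"
proof -
  have "X d p = jac c d p (X c p)" using assms(2-5) unfolding smooth_vfield_def by blast
  moreover have "p \<in> cdom c \<inter> cdom d" using assms(5) by blast
  ultimately show ?thesis using lorentzian_metricD(2)[OF assms(1,3,4)] by simp
qed

lemma smooth_on_low:
  assumes M: "smooth_manifold A" and g: "lorentzian_metric A g" and U: "open U" and c: "c \<in> A"
    and X: "smooth_on (cmap c ` (cdom c \<inter> U)) (X c \<circ> cinv c)"
  shows "smooth_on (cmap c ` (cdom c \<inter> U)) (low g X c \<circ> cinv c)"
proof -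
  let ?S = "cmap c ` (cdom c \<inter> U)"
  have op: "open ?S" using open_cmap_image[OF smooth_manifoldD(1)[OF M c] U] .
  have gS: "smooth_on ?S (g c \<circ> cinv c)"
    by (rule smooth_on_subset[OF lorentzian_metricD(1)[OF g c]]) auto
  have "smooth_on ?S (\<lambda>x. \<chi> \<mu>. \<Sum>\<nu>\<in>UNIV. (g c \<circ> cinv c) x $ \<mu> $ \<nu> * (X c \<circ> cinv c) x $ \<nu>)"
    by (intro smooth_on_vec_lambda smooth_on_sum smooth_on_mult smooth_on_vec_nth op gS X)
  then show ?thesis by (simp add: low_def comp_def)
qed

text \<open>The covector \<open>\<zeta>\<close> may vary arbitrarily with chart and point, because
  the exterior derivative is evaluated only on pairs of vectors in the kernel of the form. The
  charts come from \<open>frobenius_chart\<close>; their plaques fit together because all are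
  tangent to the same distribution.\<close>

lemma frobenius_foliation:
  fixes A :: "('m::{t2_space, second_countable_topology}, 'n::finite) chart set"
  assumes M: "smooth_manifold A" and g: "lorentzian_metric A g" and U: "open U"
    and X: "smooth_vfield A U X"
    and nz: "\<And>c p. c \<in> A \<Longrightarrow> p \<in> cdom c \<inter> U \<Longrightarrow> low g X c p \<noteq> 0"
    and closed: "\<And>c p. c \<in> A \<Longrightarrow> p \<in> cdom c \<inter> U \<Longrightarrow> \<exists>\<zeta>. \<forall>\<mu> \<nu>.
      pd c \<nu> (\<lambda>q. low g X c q $ \<mu>) p - pd c \<mu> (\<lambda>q. low g X c q $ \<nu>) p =
      \<zeta> \<mu> * low g X c p $ \<nu> - \<zeta> \<nu> * low g X c p $ \<mu>"
  shows "admits_foliation A g U X"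
proof -
  define adapted where "adapted = (\<lambda>c k. \<forall>p\<in>cdom c. orth g X c p = {v. v $ k = 0})"
  \<comment> \<open>All adapted box charts inside \<open>U\<close> are taken, and \<open>k\<close>
    chooses a transverse index for each.\<close>
  define F where "F = {c \<in> A. cdom c \<subseteq> U \<and> (\<exists>a b. cmap c ` cdom c = box a b) \<and> (\<exists>k. adapted c k)}"
  define k where "k = (\<lambda>c. SOME k. adapted c k)"
  have adapted: "adapted c (k c)" if "c \<in> F" for c
  proof -
    have "\<exists>k. adapted c k" using that by (simp add: F_def)
    then show ?thesis unfolding k_def by (rule someI_ex)
  qed
  have "\<exists>c'\<in>F. p \<in> cdom c'" if p: "p \<in> U" for p
  proof -
    obtain c where c: "c \<in> A" "p \<in> cdom c" using M unfolding smooth_manifold_def by blast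
    let ?S = "cmap c ` (cdom c \<inter> U)"
    have cc: "is_chart c" using smooth_manifoldD(1)[OF M c(1)] .
    define w where "w = low g X c \<circ> cinv c"
    have op: "open ?S" using open_cmap_image[OF cc U] .
    have w: "smooth_on ?S w"
      unfolding w_def by (rule smooth_on_low[OF M g U c(1)]) (use X c in \<open>simp add: smooth_vfield_def\<close>)
    have w_eq: "w (cmap c q) = low g X c q" if "q \<in> cdom c" for q
      using that by (simp add: w_def cinv_cmap[OF cc])
    have xS: "cmap c p \<in> ?S" using c p by blast
    have wx: "w (cmap c p) \<noteq> 0" using w_eq nz c p by simp
    \<comment> \<open>The antisymmetrised derivative is the wedge product of \<open>\<zeta>\<close>
      and \<open>w\<close>, which vanishes on two vectors annihilated by \<open>w\<close>.\<close>
    have w': "frechet_derivative w (at x) Y \<bullet> Z = frechet_derivative w (at x) Z \<bullet> Y"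
      if x: "x \<in> ?S" and YZ: "w x \<bullet> Y = 0" "w x \<bullet> Z = 0" for x Y Z
    proof -
      obtain q where q: "q \<in> cdom c \<inter> U" "x = cmap c q" using x by blast
      let ?w' = "frechet_derivative w (at x)"
      have D: "(w has_derivative ?w') (at x)" by (rule smooth_on_derivative[OF w x])
      interpret linear ?w' using D has_derivative_linear by blast
      have pd: "pd c \<nu> (\<lambda>q. low g X c q $ \<mu>) q = ?w' (axis \<nu> 1) $ \<mu>" for \<mu> \<nu>
      proof -
        have "((\<lambda>x. w x $ \<mu>) has_derivative (\<lambda>v. ?w' v $ \<mu>)) (at x)"
          using bounded_linear.has_derivative[OF bounded_linear_vec_nth D] .
        from frechet_derivative_at[OF this] show ?thesis
          by (simp add: pd_def q w_def comp_def) metis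
      qed
      have exp: "?w' Y \<bullet> Z = (\<Sum>\<mu>\<in>UNIV. \<Sum>\<nu>\<in>UNIV. ?w' (axis \<nu> 1) $ \<mu> * Y $ \<nu> * Z $ \<mu>)" for Y Z
      proof -
        have "Y = (\<Sum>\<nu>\<in>UNIV. Y $ \<nu> *\<^sub>R axis \<nu> 1)"
          by (simp add: vec_eq_iff axis_def if_distrib cong: if_cong)
        then have "?w' Y = (\<Sum>\<nu>\<in>UNIV. Y $ \<nu> *\<^sub>R ?w' (axis \<nu> 1))"
          by (metis (no_types, lifting) sum scale sum.cong)
        then show ?thesis by (simp add: inner_vec_def sum_distrib_left sum_distrib_right mult_ac)
      qed
      obtain \<zeta> where \<zeta>: "\<And>\<mu> \<nu>. ?w' (axis \<nu> 1) $ \<mu> - ?w' (axis \<mu> 1) $ \<nu> = \<zeta> \<mu> * w x $ \<nu> - \<zeta> \<nu> * w x $ \<mu>"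
        using closed[OF c(1) q(1)] w_eq q by (auto simp: pd)
      have "?w' Y \<bullet> Z - ?w' Z \<bullet> Y =
          (\<Sum>\<mu>\<in>UNIV. \<Sum>\<nu>\<in>UNIV. (?w' (axis \<nu> 1) $ \<mu> - ?w' (axis \<mu> 1) $ \<nu>) * Y $ \<nu> * Z $ \<mu>)"
        unfolding exp[of Y] exp[of Z]
        by (subst (2) sum.swap) (simp add: sum_subtractf[symmetric] algebra_simps)
      also have "\<dots> = (\<Sum>\<mu>\<in>UNIV. \<zeta> \<mu> * Z $ \<mu>) * (w x \<bullet> Y) - (w x \<bullet> Z) * (\<Sum>\<nu>\<in>UNIV. \<zeta> \<nu> * Y $ \<nu>)"
        unfolding inner_vec_def sum_product by (simp add: \<zeta> sum_subtractf[symmetric] algebra_simps)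
      finally show ?thesis using YZ by simp
    qed
    obtain a b :: "real ^ 'n" and V j \<Phi> \<Psi> where V: "open V" "cmap c p \<in> V" "V \<subseteq> ?S"
      "homeomorphism V (box a b) \<Phi> \<Psi>" "smooth_on V \<Phi>" "smooth_on (box a b) \<Psi>"
      and ker: "\<And>y h. y \<in> V \<Longrightarrow> frechet_derivative \<Phi> (at y) h $ j = 0 \<longleftrightarrow> w y \<bullet> h = 0"
      by (rule frobenius_chart[OF op xS wx w w']) (assumption | rule that)+
    have Vc: "V \<subseteq> cmap c ` cdom c" using V(3) by blast
    define c' where "c' = (cinv c ` V, \<Phi> \<circ> cmap c)"
    have c'A: "c' \<in> A"
      unfolding c'_def by (rule subchart_in_atlas[OF M c(1) V(1) Vc V(4-6)])
    have dom: "cdom c' = {p \<in> cdom c. cmap c p \<in> V}"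
      using cinv_image[OF cc Vc] by (simp add: c'_def)
    have domU: "cdom c' \<subseteq> U"
    proof
      fix q assume "q \<in> cdom c'"
      then obtain r where "q \<in> cdom c" "r \<in> cdom c \<inter> U" "cmap c q = cmap c r"
        using V(3) unfolding dom by blast
      then show "q \<in> U" using cinv_cmap[OF cc] by (metis IntD1 IntD2)
    qed
    have "cmap c' ` cdom c' = \<Phi> ` (cmap c ` (cinv c ` V))" by (simp add: c'_def image_comp)
    also have "cmap c ` (cinv c ` V) = V" by (rule cmap_cinv_image[OF cc Vc])
    also have "\<Phi> ` V = box a b" by (rule homeomorphism_image1[OF V(4)])
    finally have box: "cmap c' ` cdom c' = box a b" .
    have "orth g X c' q = {v. v $ j = 0}" if q: "q \<in> cdom c'" for q
    proof -
      have qc: "q \<in> cdom c \<inter> cdom c' \<inter> U" "q \<in> cdom c' \<inter> cdom c" "q \<in> cdom c \<inter> cdom c'"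
        and qV: "cmap c q \<in> V" using q dom domU by auto
      \<comment> \<open>Near the point the transition map to the new chart is \<open>\<Phi>\<close>,
        so its Jacobian is the derivative whose component \<open>j\<close> was computed in
        \<open>ker\<close>.\<close>
      have "(transition c c' has_derivative jac c c' q) (at (cmap c q))"
        using transition_derivative[OF M c(1) c'A qc(3)] .
      then have "(\<Phi> has_derivative jac c c' q) (at (cmap c q))"
        by (rule has_derivative_transform_within_open[OF _ V(1) qV])
          (use Vc in \<open>auto simp: transition_def c'_def cinv_cmap[OF cc] subset_iff image_iff\<close>)
      then have jac: "jac c c' q = frechet_derivative \<Phi> (at (cmap c q))"
        using frechet_derivative_at by blast
      have "v \<in> orth g X c' q \<longleftrightarrow> v $ j = 0" for v
      proof -
        let ?v = "jac c' c q v"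
        have v: "jac c c' q ?v = v" by (rule jac_inverse[OF M c'A c(1) qc(2)])
        have "v \<in> orth g X c' q \<longleftrightarrow> gprod g c q (X c q) ?v = 0"
          unfolding orth_def using gprod_jac[OF g X c(1) c'A qc(1), of ?v] v by simp
        also have "\<dots> \<longleftrightarrow> w (cmap c q) \<bullet> ?v = 0"
          using inner_low[of g c q X ?v] lorentzian_metricD(3)[OF g c(1)] qc w_eq by simp
        also have "\<dots> \<longleftrightarrow> v $ j = 0" using ker[OF qV, of ?v] v jac by simp
        finally show ?thesis .
      qed
      then show ?thesis by blast
    qed
    then have "adapted c' j" by (simp add: adapted_def)
    then have "c' \<in> F"
      unfolding F_def using c'A domU box by (intro CollectI conjI exI)
    moreover have "p \<in> cdom c'" using c V(2) dom by blast
    ultimately show ?thesis by blast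
  qed
  moreover have F: "c \<in> A" "cdom c \<subseteq> U" if "c \<in> F" for c using that by (auto simp: F_def)
  ultimately have cover: "(\<Union>c\<in>F. cdom c) = U" by blast
  have "\<exists>W. open W \<and> p \<in> W \<and> W \<subseteq> cdom c \<inter> cdom d \<and>
      (\<forall>q\<in>W. \<forall>r\<in>W. cmap c q $ k c = cmap c r $ k c \<longrightarrow> cmap d q $ k d = cmap d r $ k d)"
    if cd: "c \<in> F" "d \<in> F" and p: "p \<in> cdom c \<inter> cdom d" for c d p
  proof -
    have A: "c \<in> A" "d \<in> A" and U: "cdom c \<subseteq> U" using cd F by auto
    have cc: "is_chart c" using smooth_manifoldD(1)[OF M A(1)] .
    let ?O = "cmap c ` (cdom c \<inter> cdom d)"
    have "open ?O" "cmap c p \<in> ?O" using open_overlap[OF M A] p by auto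
    \<comment> \<open>A ball in the coordinates of \<open>c\<close> is convex, so segments between
      its points stay in the overlap.\<close>
    then obtain r where r: "r > 0" "ball (cmap c p) r \<subseteq> ?O" using open_contains_ball by blast
    let ?B = "ball (cmap c p) r"
    have sub: "?B \<subseteq> cmap c ` cdom c" using r by blast
    have W: "cinv c ` ?B \<subseteq> cdom c \<inter> cdom d"
    proof
      fix q assume "q \<in> cinv c ` ?B"
      then obtain s where "s \<in> cdom c \<inter> cdom d" "q = cinv c (cmap c s)" using r(2) by blast
      then show "q \<in> cdom c \<inter> cdom d" using cinv_cmap[OF cc] by auto
    qed
    show ?thesis
    proof (intro exI[of _ "cinv c ` ?B"] conjI ballI impI W)
      show "open (cinv c ` ?B)" using open_cinv_image[OF cc open_ball sub] .
      show "p \<in> cinv c ` ?B" using cinv_image[OF cc sub] p r(1) by auto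
    next
      fix q s assume q: "q \<in> cinv c ` ?B" and s: "s \<in> cinv c ` ?B"
        and eq: "cmap c q $ k c = cmap c s $ k c"
      have B: "cmap c q \<in> ?B" "cmap c s \<in> ?B" using q s cinv_image[OF cc sub] by auto
      have seg: "closed_segment (cmap c q) (cmap c s) \<subseteq> ?O"
        using closed_segment_subset[OF B convex_ball] r(2) by blast
      have "transition c d (cmap c s) $ k d = transition c d (cmap c q) $ k d"
      proof (rule constant_along_segment[where f = "\<lambda>x. transition c d x $ k d"
            and f' = "\<lambda>z v. jac c d (cinv c z) v $ k d"])
        fix z assume "z \<in> closed_segment (cmap c q) (cmap c s)"
        then obtain p' where p': "p' \<in> cdom c \<inter> cdom d" "z = cmap c p'" using seg by blast
        then have p'U: "p' \<in> cdom c \<inter> cdom d \<inter> U" using U by blast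
        have z: "z \<in> ?O" "cinv c z = p'" using p' cinv_cmap[OF cc] by auto
        show "((\<lambda>x. transition c d x $ k d) has_derivative (\<lambda>v. jac c d (cinv c z) v $ k d)) (at z)"
          using bounded_linear.has_derivative[OF bounded_linear_vec_nth transition_derivative[OF M A p'(1)]]
            z p' by simp
        \<comment> \<open>The direction of the segment has vanishing component \<open>k c\<close>,
          hence is orthogonal to \<open>X\<close> at each of its points. The transition map
          preserves orthogonality, so component \<open>k d\<close> of its image vanishes.\<close>
        have "cmap c s - cmap c q \<in> orth g X c p'"
          using adapted[OF cd(1)] p' eq unfolding adapted_def by auto
        then have "jac c d p' (cmap c s - cmap c q) \<in> orth g X d p'"
          unfolding orth_def using gprod_jac[OF g X A p'U] by simp
        then show "jac c d (cinv c z) (cmap c s - cmap c q) $ k d = 0"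
          using adapted[OF cd(2)] p' z unfolding adapted_def by auto
      qed
      moreover have "q \<in> cdom c" "s \<in> cdom c" using q s W by auto
      ultimately show "cmap d q $ k d = cmap d s $ k d"
        by (simp add: transition_def cinv_cmap[OF cc])
    qed
  qed
  then have "hypersurface_foliation A U F k"
    unfolding hypersurface_foliation_def using cover by (auto simp: F_def)
  then show ?thesis
    unfolding admits_foliation_def
    by (intro exI[of _ F] exI[of _ k] conjI) (use adapted in \<open>auto simp: adapted_def\<close>)
qed


section \<open>The vorticity of the transformed observer\<close>

text \<open>Both functions have exactly the same derivatives at the point, so the values chosen by
  \<open>frechet_derivative\<close> coincide. Symmetry of the metric, known on the chart domain
  only, thus passes to its partial derivatives.\<close>

lemma pd_cong:
  assumes c: "is_chart c" and p: "p \<in> cdom c" and eq: "\<And>q. q \<in> cdom c \<Longrightarrow> F q = G q"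
  shows "pd c \<mu> F p = pd c \<mu> G p"
proof -
  have op: "open (cmap c ` cdom c)" using c by (simp add: is_chart_def)
  have x: "cmap c p \<in> cmap c ` cdom c" using p by blast
  have FG: "(F \<circ> cinv c) x = (G \<circ> cinv c) x" if "x \<in> cmap c ` cdom c" for x
    using that eq cinv_cmap[OF c] by auto
  have "(F \<circ> cinv c has_derivative D) (at (cmap c p)) \<longleftrightarrow> (G \<circ> cinv c has_derivative D) (at (cmap c p))" for D
    using has_derivative_transform_within_open[OF _ op x] FG by metis
  then show ?thesis by (simp add: pd_def frechet_derivative_def)
qed

lemma pd_add:
  assumes "(F \<circ> cinv c) differentiable (at (cmap c p))" "(G \<circ> cinv c) differentiable (at (cmap c p))"
  shows "pd c \<mu> (\<lambda>q. F q + G q) p = pd c \<mu> F p + pd c \<mu> G p"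
proof -
  from has_derivative_add[OF assms[unfolded frechet_derivative_works]]
  have "((\<lambda>q. F q + G q) \<circ> cinv c has_derivative
      (\<lambda>h. frechet_derivative (F \<circ> cinv c) (at (cmap c p)) h + frechet_derivative (G \<circ> cinv c) (at (cmap c p)) h))
      (at (cmap c p))"
    by (simp add: comp_def)
  from fun_cong[OF frechet_derivative_at[OF this], of "axis \<mu> 1"] show ?thesis
    by (simp add: pd_def)
qed

lemma pd_mult:
  assumes "(F \<circ> cinv c) differentiable (at (cmap c p))" "(G \<circ> cinv c) differentiable (at (cmap c p))"
    and "is_chart c" "p \<in> cdom c"
  shows "pd c \<mu> (\<lambda>q. F q * G q) p = F p * pd c \<mu> G p + pd c \<mu> F p * G p"
proof -
  from has_derivative_mult[OF assms(1,2)[unfolded frechet_derivative_works]]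
  have "((\<lambda>q. F q * G q) \<circ> cinv c has_derivative
      (\<lambda>h. F p * frechet_derivative (G \<circ> cinv c) (at (cmap c p)) h +
        frechet_derivative (F \<circ> cinv c) (at (cmap c p)) h * G p))
      (at (cmap c p))"
    by (simp add: comp_def cinv_cmap[OF assms(3,4)])
  from fun_cong[OF frechet_derivative_at[OF this], of "axis \<mu> 1"] show ?thesis
    by (simp add: pd_def)
qed

lemma christoffel_sym:
  assumes g: "lorentzian_metric A g" and c: "c \<in> A" "is_chart c" and p: "p \<in> cdom c"
  shows "christoffel g c p l m k = christoffel g c p l k m"
proof -
  have "pd c \<rho> (\<lambda>q. g c q $ m $ k) p = pd c \<rho> (\<lambda>q. g c q $ k $ m) p" for \<rho>
    by (rule pd_cong[OF c(2) p]) (rule symmetric_nth[OF lorentzian_metricD(3)[OF g c(1)]])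
  then show ?thesis by (simp add: christoffel_def add.commute)
qed

text \<open>The exterior derivative does not see the connection, because it is torsion free.\<close>

lemma nabla_cov_antisym:
  assumes "lorentzian_metric A g" "c \<in> A" "is_chart c" "p \<in> cdom c"
  shows "nabla_cov g w c p \<mu> \<nu> - nabla_cov g w c p \<nu> \<mu> =
    pd c \<mu> (\<lambda>q. w c q $ \<nu>) p - pd c \<nu> (\<lambda>q. w c q $ \<mu>) p"
  using christoffel_sym[OF assms, of _ \<mu> \<nu>] by (simp add: nabla_cov_def)

section \<open>Linear combinations of fields and their lowered components\<close>

lemma low_add: "low g (\<lambda>c p. X c p + Y c p) c p = low g X c p + low g Y c p"
  by (simp add: low_def vec_eq_iff distrib_left sum.distrib)

lemma low_scaleR: "low g (\<lambda>c p. f p *\<^sub>R X c p) c p = f p *\<^sub>R low g X c p"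
  by (simp add: low_def vec_eq_iff sum_distrib_left mult_ac)

lemma gprod_sum:
  "gprod g c p (\<Sum>i\<in>I. a i *\<^sub>R v i) w = (\<Sum>i\<in>I. a i * gprod g c p (v i) w)"
  "gprod g c p w (\<Sum>i\<in>I. a i *\<^sub>R v i) = (\<Sum>i\<in>I. a i * gprod g c p w (v i))"
proof -
  have *: "gprod g c p v w = v \<bullet> (\<chi> \<mu>. \<Sum>\<nu>\<in>UNIV. g c p $ \<mu> $ \<nu> * w $ \<nu>)"
    "gprod g c p w v = v \<bullet> (\<chi> \<nu>. \<Sum>\<mu>\<in>UNIV. g c p $ \<mu> $ \<nu> * w $ \<mu>)" for v w
    unfolding gprod_def inner_vec_def
    by (simp_all add: sum_distrib_left sum_distrib_right mult_ac) (subst sum.swap, simp)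
  show "gprod g c p (\<Sum>i\<in>I. a i *\<^sub>R v i) w = (\<Sum>i\<in>I. a i * gprod g c p (v i) w)"
    unfolding *(1) by (simp add: inner_sum_left)
  show "gprod g c p w (\<Sum>i\<in>I. a i *\<^sub>R v i) = (\<Sum>i\<in>I. a i * gprod g c p w (v i))"
    unfolding *(2) by (simp add: inner_sum_left)
qed

lemma smooth_vfield_sum:
  assumes M: "smooth_manifold A" and U: "open U"
    and X: "\<And>i. i \<in> I \<Longrightarrow> smooth_vfield A U (X i)" and h: "\<And>i. i \<in> I \<Longrightarrow> smooth_scalar A U (h i)"
  shows "smooth_vfield A U (\<lambda>c p. \<Sum>i\<in>I. h i p *\<^sub>R X i c p)"
  unfolding smooth_vfield_def
proof (intro conjI ballI)
  fix c assume c: "c \<in> A"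
  let ?S = "cmap c ` (cdom c \<inter> U)"
  have op: "open ?S" using open_cmap_image[OF smooth_manifoldD(1)[OF M c] U] .
  have "smooth_on ?S (\<lambda>x. \<Sum>i\<in>I. (h i \<circ> cinv c) x *\<^sub>R (X i c \<circ> cinv c) x)"
  proof (intro smooth_on_sum smooth_on_scaleR op)
    fix i assume i: "i \<in> I"
    show "smooth_on ?S (\<lambda>x. (h i \<circ> cinv c) x)"
      using h[OF i] c by (simp add: smooth_scalar_def comp_def)
    show "smooth_on ?S (\<lambda>x. (X i c \<circ> cinv c) x)"
      using X[OF i] c by (simp add: smooth_vfield_def comp_def)
  qed
  then show "smooth_on ?S ((\<lambda>p. \<Sum>i\<in>I. h i p *\<^sub>R X i c p) \<circ> cinv c)" by (simp add: comp_def)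
next
  fix c d p assume A: "c \<in> A" "d \<in> A" and p: "p \<in> cdom c \<inter> cdom d \<inter> U"
  have "p \<in> cdom c \<inter> cdom d" using p by blast
  from transition_derivative[OF M A this] interpret linear "jac c d p"
    by (rule has_derivative_linear)
  have "X i d p = jac c d p (X i c p)" if "i \<in> I" for i
    using X[OF that] A p unfolding smooth_vfield_def by blast
  then show "(\<Sum>i\<in>I. h i p *\<^sub>R X i d p) = jac c d p (\<Sum>i\<in>I. h i p *\<^sub>R X i c p)"
    by (simp add: sum scale)
qed

lemma low_differentiable:
  assumes "smooth_manifold A" "lorentzian_metric A g" "open U" "c \<in> A" "smooth_vfield A U X"
    and p: "p \<in> cdom c \<inter> U"
  shows "((\<lambda>q. low g X c q $ \<mu>) \<circ> cinv c) differentiable (at (cmap c p))"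
proof -
  have "smooth_on (cmap c ` (cdom c \<inter> U)) (low g X c \<circ> cinv c)"
    by (rule smooth_on_low[OF assms(1-4)]) (use assms(4,5) in \<open>simp add: smooth_vfield_def\<close>)
  then have "((low g X c \<circ> cinv c) has_derivative frechet_derivative (low g X c \<circ> cinv c) (at (cmap c p))) (at (cmap c p))"
    by (rule smooth_on_derivative) (use p in blast)
  from bounded_linear.has_derivative[OF bounded_linear_vec_nth this]
  show ?thesis by (auto simp: comp_def intro: differentiableI)
qed

theorem theorem3p2:
  fixes A :: "('m::{t2_space, second_countable_topology}, 'n::finite) chart set"
    and g :: "('m, 'n) metric"
    and U :: "'m set"
    and e :: "nat \<Rightarrow> ('m, 'n) vfield"
    and \<Lambda> :: "nat \<Rightarrow> nat \<Rightarrow> 'm \<Rightarrow> real"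
    and u b u' :: "('m, 'n) vfield"
    and f :: "'m \<Rightarrow> real"
  assumes dim: "CARD('n) \<ge> 2"
    and M: "spacetime A g"
    and U: "open U"
    and e: "tetrad A g U e"
    and Lorentz: "local_lorentz A U \<Lambda>"
    and u: "u = e 0"
    and f: "f = \<Lambda> 0 0"
    and b: "b = (\<lambda>c p. \<Sum>i = 1..<CARD('n). \<Lambda> i 0 p *\<^sub>R e i c p)"
    and u': "u' = (\<lambda>c p. \<Sum>B<CARD('n). \<Lambda> B 0 p *\<^sub>R e B c p)"
    and vorticity_free: "\<forall>c\<in>A. \<forall>p\<in>cdom c \<inter> U. \<forall>\<mu> \<nu>. vorticity g u c p \<mu> \<nu> = 0"
    and eq: "\<forall>c\<in>A. \<forall>p\<in>cdom c \<inter> U. \<forall>\<mu> \<nu>.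
      0 = antisym2 (\<lambda>\<alpha> \<beta>. low g u c p $ \<alpha> * pd c \<beta> f p) \<mu> \<nu>
        + antisym2 (\<lambda>\<alpha> \<beta>. nabla_cov g (low g b) c p \<alpha> \<beta>) \<nu> \<mu>
        + f p * antisym2 (\<lambda>\<alpha> \<beta>. low g (accel g u) c p $ \<alpha> *
                               (f p * low g u' c p $ \<beta> - low g u c p $ \<beta>)) \<mu> \<nu>
        + antisym2 (\<lambda>\<alpha> \<beta>. low g u c p $ \<alpha> * low g b c p $ \<beta>) \<mu> \<nu> *
            (along_scalar u' f c p - 1 / (real CARD('n) - 1) * expansion g u c p * (f p)\<^sup>2)
        + antisym2 (\<lambda>\<alpha> \<beta>. (along_cov g u' (low g b) c p $ \<alpha> +
                          f p * (\<Sum>\<rho>\<in>UNIV. b c p $ \<rho> * shear g u c p \<rho> \<alpha>)) * low g u' c p $ \<beta>) \<mu> \<nu>"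
  shows "admits_foliation A g U u'"
proof -
  have SM: "smooth_manifold A" and g: "lorentzian_metric A g" using M by (auto simp: spacetime_def)
  have sm_e: "smooth_vfield A U (e B)" if "B < CARD('n)" for B
    using e that by (simp add: tetrad_def)
  have sm_\<Lambda>: "smooth_scalar A U (\<Lambda> B 0)" if "B < CARD('n)" for B
    using Lorentz that dim by (simp add: local_lorentz_def)
  have sm_u': "smooth_vfield A U u'"
    unfolding u' by (rule smooth_vfield_sum[OF SM U]) (use sm_e sm_\<Lambda> in auto)
  have sm_b: "smooth_vfield A U b"
    unfolding b by (rule smooth_vfield_sum[OF SM U]) (use sm_e sm_\<Lambda> in auto)
  have sm_u: "smooth_vfield A U u" unfolding u using sm_e dim by simp
  have sm_f: "smooth_scalar A U f" unfolding f using sm_\<Lambda> dim by simp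
  have u'_eq: "u' = (\<lambda>c p. f p *\<^sub>R u c p + b c p)"
    unfolding u' f u b lessThan_atLeast0 by (subst sum.atLeast_Suc_lessThan) (use dim in auto)
  have low_u': "low g u' c p $ \<mu> = f p * low g u c p $ \<mu> + low g b c p $ \<mu>" for c p \<mu>
    by (simp add: u'_eq low_add low_scaleR)
  show ?thesis
  proof (rule frobenius_foliation[OF SM g U sm_u'])
    fix c p assume c: "c \<in> A" and p: "p \<in> cdom c \<inter> U"
    \<comment> \<open>The Lorentz condition for the column 0 shows that the transformed observer is
      again a unit timelike vector; hence its lowered form vanishes nowhere.\<close>
    have "gprod g c p (u' c p) (u' c p) =
        (\<Sum>B<CARD('n). \<Sum>C<CARD('n). \<Lambda> B 0 p * (\<Lambda> C 0 p * gprod g c p (e C c p) (e B c p)))"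
      unfolding u' gprod_sum by (simp add: sum_distrib_left)
    also have "\<dots> = (\<Sum>B<CARD('n). \<Sum>C<CARD('n). \<eta> B C * \<Lambda> B 0 p * \<Lambda> C 0 p)"
      using e c p by (intro sum.cong refl) (auto simp: tetrad_def \<eta>_def)
    also have "\<dots> = \<eta> 0 0" using Lorentz p dim by (simp add: local_lorentz_def)
    finally have "low g u' c p \<bullet> u' c p = - 1"
      using inner_low[of g c p u'] lorentzian_metricD(3)[OF g c] p by (simp add: \<eta>_def)
    then show "low g u' c p \<noteq> 0" by auto
    have cc: "is_chart c" using smooth_manifoldD(1)[OF SM c] .
    have pc: "p \<in> cdom c" using p by blast
    have df: "(f \<circ> cinv c) differentiable (at (cmap c p))"
      by (rule differentiableI[OF smooth_on_derivative])
        (use sm_f c p in \<open>auto simp: smooth_scalar_def\<close>)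
    have pd_u': "pd c \<mu> (\<lambda>q. low g u' c q $ \<nu>) p =
        f p * pd c \<mu> (\<lambda>q. low g u c q $ \<nu>) p + pd c \<mu> f p * low g u c p $ \<nu> +
        pd c \<mu> (\<lambda>q. low g b c q $ \<nu>) p" for \<mu> \<nu>
    proof -
      have du: "((\<lambda>q. low g u c q $ \<nu>) \<circ> cinv c) differentiable (at (cmap c p))"
        and db: "((\<lambda>q. low g b c q $ \<nu>) \<circ> cinv c) differentiable (at (cmap c p))"
        using low_differentiable[OF SM g U c _ p] sm_u sm_b by auto
      have "((\<lambda>q. f q * low g u c q $ \<nu>) \<circ> cinv c) differentiable (at (cmap c p))"
        using differentiable_mult[OF df du] by (simp add: comp_def)
      from pd_add[OF this db] show ?thesis
        unfolding low_u' pd_mult[OF df du cc pc] .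
    qed
    define a where "a = (\<lambda>\<mu>. low g (accel g u) c p $ \<mu>)"
    define T where "T = along_scalar u' f c p - 1 / (real CARD('n) - 1) * expansion g u c p * (f p)\<^sup>2"
    define \<xi> where "\<xi> = (\<lambda>\<alpha>. along_cov g u' (low g b) c p $ \<alpha> +
                          f p * (\<Sum>\<rho>\<in>UNIV. b c p $ \<rho> * shear g u c p \<rho> \<alpha>))"
    show "\<exists>\<zeta>. \<forall>\<mu> \<nu>. pd c \<nu> (\<lambda>q. low g u' c q $ \<mu>) p - pd c \<mu> (\<lambda>q. low g u' c q $ \<nu>) p =
      \<zeta> \<mu> * low g u' c p $ \<nu> - \<zeta> \<nu> * low g u' c p $ \<mu>"
    \<comment> \<open>The acceleration term from the vanishing vorticity cancels the part of the
      hypothesis linear in \<open>f\<close>, leaving \<open>f\<^sup>2\<close> times the wedge of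
      \<open>a\<close> with the lowered \<open>u'\<close>. In the \<open>T\<close> term,
      \<open>b\<close> may be replaced by \<open>u'\<close>, as they differ by a multiple of
      \<open>u\<close>. The bracket with \<open>\<xi>\<close> already has \<open>u'\<close> as a
      factor.\<close>
    proof (intro exI[of _ "\<lambda>\<mu>. - ((f p)\<^sup>2 * a \<mu> + T * low g u c p $ \<mu> + \<xi> \<mu>)"] allI)
      fix \<mu> \<nu>
      let ?N = "\<lambda>w. nabla_cov g (low g w) c p \<nu> \<mu> - nabla_cov g (low g w) c p \<mu> \<nu>"
      let ?u = "low g u c p" and ?b = "low g b c p"
      have vort: "?N u = - (a \<mu> * ?u $ \<nu> - a \<nu> * ?u $ \<mu>)"
        using vorticity_free[rule_format, OF c p, of \<mu> \<nu>]
        by (simp add: vorticity_def antisym2_def a_def field_simps)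
      \<comment> \<open>The hypothesis multiplied by 2, which removes the factor 1/2 of each
        antisymmetrisation.\<close>
      have "0 = (?u $ \<mu> * pd c \<nu> f p - ?u $ \<nu> * pd c \<mu> f p) + ?N b
        + f p * (a \<mu> * (f p * low g u' c p $ \<nu> - ?u $ \<nu>) - a \<nu> * (f p * low g u' c p $ \<mu> - ?u $ \<mu>))
        + (?u $ \<mu> * ?b $ \<nu> - ?u $ \<nu> * ?b $ \<mu>) * T
        + (\<xi> \<mu> * low g u' c p $ \<nu> - \<xi> \<nu> * low g u' c p $ \<mu>)"
        using eq[rule_format, OF c p, of \<mu> \<nu>]
        unfolding antisym2_def T_def[symmetric] fun_cong[OF \<xi>_def[symmetric]] fun_cong[OF a_def[symmetric]]
        by (simp add: algebra_simps)
      moreover have "pd c \<nu> (\<lambda>q. low g u' c q $ \<mu>) p - pd c \<mu> (\<lambda>q. low g u' c q $ \<nu>) p =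
          f p * ?N u + ?N b + (pd c \<nu> f p * ?u $ \<mu> - pd c \<mu> f p * ?u $ \<nu>)"
        unfolding nabla_cov_antisym[OF g c cc pc] pd_u' by (simp add: algebra_simps)
      ultimately show "pd c \<nu> (\<lambda>q. low g u' c q $ \<mu>) p - pd c \<mu> (\<lambda>q. low g u' c q $ \<nu>) p =
          - ((f p)\<^sup>2 * a \<mu> + T * ?u $ \<mu> + \<xi> \<mu>) * low g u' c p $ \<nu> -
          - ((f p)\<^sup>2 * a \<nu> + T * ?u $ \<nu> + \<xi> \<nu>) * low g u' c p $ \<mu>"
        unfolding vort low_u' by (simp add: power2_eq_square) algebra
    qed
  qed
qed

end
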